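(* Let $p,k\in\mathbb{N}$, $M>0$, and let $(\mathcal{J}_0,\mathcal{J}_1,\mathcal{J}_f)$ be a partition of $[p]=\{1,\dots,p\}$ with $|\mathcal{J}_1|\le k$. Let $g_{\mathcal{N}}:\mathbb{R}^p\to\overline{\mathbb{R}}$ be $$g_{\mathcal{N}}(\beta):=\inf_{z\in\mathbb{R}^p}\Big\{\tfrac12\sum_{j\in[p]}\beta_j^2/z_j\ :\ (\beta,z)\in\mathcal{D}\Big\},$$ where $\mathcal{D}$ is the set of $(\beta,z)\in\mathbb{R}^{2p}$ with $\mathbf{1}^\top z\le k$, $|\beta_j|\le Mz_j$ for all $j\in[p]$, $z_j=0$ for $j\in\mathcal{J}_0$, $z_j=1$ for $j\in\mathcal{J}_1$, and $z_j\in[0,1]$ for $j\in\mathcal{J}_f$. Then $g_{\mathcal{N}}$ and its Fenchel conjugate $g_{\mathcal{N}}^*$ are both piecewise linear-quadratic and firmly convex.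
   Context: Conventions: $\beta_j^2/z_j$ is $0$ if $\beta_j=z_j=0$ and $+\infty$ if $\beta_j\ne0$, $z_j=0$; the infimum over an empty set is $+\infty$; $h^*(\alpha)=\sup_\beta\{\beta^\top\alpha-h(\beta)\}$. Piecewise linear-quadratic (PLQ): $h$ is PLQ if $\operatorname{dom}(h)=\{h<+\infty\}$ is a union of finitely many polyhedral sets, on each of which $h(\beta)=\frac12\beta^\top Q\beta+b^\top\beta+c$ for some symmetric matrix $Q$, vector $b$ and scalar $c$ (depending on the piece). Firmly convex: a proper, closed, convex $h:\mathbb{R}^p\to\overline{\mathbb{R}}$ is firmly convex relative to $\nu\in\mathbb{R}^p$ if, with $h_\nu(\beta):=h(\beta)-\nu^\top\beta$, for any compact $\mathcal{K}\subset\mathbb{R}^p$ there is $\kappa>0$ with $h_\nu(\beta)\ge\inf h_\nu+\frac{\kappa}{2}\operatorname{dist}^2\big(\beta,(\partial h_\nu)^{-1}(0)\big)$ for all $\beta\in\mathcal{K}$, where $(\partial h_\nu)^{-1}(0)$ is the set of minimizers of $h_\nu$ and $\operatorname{dist}$ is Euclidean distance to a set. $h$ is firmly convex if it is firmly convex relative to every $\nu$ for which $(\partial h_\nu)^{-1}(0)$ is nonempty. *)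

theory Defs
  imports "HOL-Analysis.Analysis"
begin

section \<open>Extended-real-valued functions on Euclidean space\<close>

definition dom_of :: "(real^'n \<Rightarrow> ereal) \<Rightarrow> (real^'n) set" where
  "dom_of h = {\<beta>. h \<beta> < \<infinity>}"

definition proper_fun :: "(real^'n \<Rightarrow> ereal) \<Rightarrow> bool" where
  "proper_fun h \<longleftrightarrow> (\<forall>\<beta>. h \<beta> \<noteq> -\<infinity>) \<and> (\<exists>\<beta>. h \<beta> \<noteq> \<infinity>)"

text \<open>The epigraph is a subset of the finite-dimensional space of pairs (point, real number);
  convexity and closedness of an extended-real-valued function are those of its epigraph.\<close>

definition epi :: "(real^'n \<Rightarrow> ereal) \<Rightarrow> ((real^'n) \<times> real) set" where
  "epi h = {(\<beta>, t). h \<beta> \<le> ereal t}"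

definition convex_fun :: "(real^'n \<Rightarrow> ereal) \<Rightarrow> bool" where
  "convex_fun h \<longleftrightarrow> convex (epi h)"

definition closed_fun :: "(real^'n \<Rightarrow> ereal) \<Rightarrow> bool" where
  "closed_fun h \<longleftrightarrow> closed (epi h)"

definition fenchel_conjugate :: "(real^'n \<Rightarrow> ereal) \<Rightarrow> real^'n \<Rightarrow> ereal" where
  "fenchel_conjugate h \<alpha> = (SUP \<beta>. ereal (\<alpha> \<bullet> \<beta>) - h \<beta>)"

definition subdifferential :: "(real^'n \<Rightarrow> ereal) \<Rightarrow> real^'n \<Rightarrow> (real^'n) set" where
  "subdifferential h \<beta> = {v. \<forall>\<gamma>. h \<gamma> \<ge> h \<beta> + ereal (v \<bullet> (\<gamma> - \<beta>))}"

definition subdifferential_inv :: "(real^'n \<Rightarrow> ereal) \<Rightarrow> real^'n \<Rightarrow> (real^'n) set" where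
  "subdifferential_inv h v = {\<beta>. v \<in> subdifferential h \<beta>}"

lemma subdifferential_inv_0_eq_minimizers:
  "subdifferential_inv h 0 = {\<beta>. \<forall>\<gamma>. h \<beta> \<le> h \<gamma>}"
  by (simp add: subdifferential_inv_def subdifferential_def zero_ereal_def[symmetric])


section \<open>Piecewise linear-quadratic functions\<close>

definition plq :: "(real^'n \<Rightarrow> ereal) \<Rightarrow> bool" where
  "plq h \<longleftrightarrow>
     (\<exists>\<P>. finite \<P> \<and> dom_of h = \<Union>\<P> \<and>
        (\<forall>P\<in>\<P>. polyhedron P \<and>
           (\<exists>(Q :: real^'n^'n) b c. transpose Q = Q \<and>
              (\<forall>\<beta>\<in>P. h \<beta> = ereal (1/2 * (\<beta> \<bullet> (Q *v \<beta>)) + b \<bullet> \<beta> + c)))))"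


section \<open>Firm convexity\<close>

definition tilt :: "(real^'n \<Rightarrow> ereal) \<Rightarrow> real^'n \<Rightarrow> real^'n \<Rightarrow> ereal" where
  "tilt h \<nu> \<beta> = h \<beta> - ereal (\<nu> \<bullet> \<beta>)"

text \<open>Pitfall: the library sets \<open>infdist \<beta> {} = 0\<close>, so the growth condition holds vacuously when
  there are no minimizers; \<open>firmly_convex\<close> only consults those \<open>\<nu>\<close> for which there are some.\<close>

definition firmly_convex_rel :: "(real^'n \<Rightarrow> ereal) \<Rightarrow> real^'n \<Rightarrow> bool" where
  "firmly_convex_rel h \<nu> \<longleftrightarrow>
     proper_fun h \<and> closed_fun h \<and> convex_fun h \<and>
     (\<forall>K. compact K \<longrightarrow>
        (\<exists>\<kappa>>0. \<forall>\<beta>\<in>K.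
           tilt h \<nu> \<beta> \<ge> (INF \<gamma>. tilt h \<nu> \<gamma>)
             + ereal (\<kappa> / 2 * (infdist \<beta> (subdifferential_inv (tilt h \<nu>) 0))\<^sup>2)))"

definition firmly_convex :: "(real^'n \<Rightarrow> ereal) \<Rightarrow> bool" where
  "firmly_convex h \<longleftrightarrow>
     proper_fun h \<and> closed_fun h \<and> convex_fun h \<and>
     (\<forall>\<nu>. subdifferential_inv (tilt h \<nu>) 0 \<noteq> {} \<longrightarrow> firmly_convex_rel h \<nu>)"


section \<open>The node function\<close>

text \<open>The quotient \<open>b\<^sup>2 / z\<close> with the conventions \<open>0\<^sup>2 / 0 = 0\<close> and \<open>b\<^sup>2 / 0 = \<infinity>\<close> for \<open>b \<noteq> 0\<close>;
  only \<open>z \<ge> 0\<close> is relevant.\<close>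

definition sq_over :: "real \<Rightarrow> real \<Rightarrow> ereal" where
  "sq_over b z = (if z = 0 then (if b = 0 then 0 else \<infinity>) else ereal (b\<^sup>2 / z))"

definition node_feasible ::
  "nat \<Rightarrow> real \<Rightarrow> 'n set \<Rightarrow> 'n set \<Rightarrow> 'n set \<Rightarrow> ((real^'n) \<times> (real^'n)) set" where
  "node_feasible k M J0 J1 Jf =
     {(\<beta>, z). (\<Sum>j\<in>UNIV. z $ j) \<le> real k \<and>
              (\<forall>j. \<bar>\<beta> $ j\<bar> \<le> M * z $ j) \<and>
              (\<forall>j\<in>J0. z $ j = 0) \<and>
              (\<forall>j\<in>J1. z $ j = 1) \<and>
              (\<forall>j\<in>Jf. z $ j \<in> {0..1})}"

text \<open>The infimum is taken in \<^typ>\<open>ereal\<close>, so it is \<open>\<infinity>\<close> if no \<open>z\<close> is feasible for \<open>\<beta>\<close>.\<close>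

definition node_fun ::
  "nat \<Rightarrow> real \<Rightarrow> 'n set \<Rightarrow> 'n set \<Rightarrow> 'n set \<Rightarrow> real^'n \<Rightarrow> ereal" where
  "node_fun k M J0 J1 Jf \<beta> =
     (INF z\<in>{z. (\<beta>, z) \<in> node_feasible k M J0 J1 Jf}.
        ereal (1/2) * (\<Sum>j\<in>UNIV. sq_over (\<beta> $ j) (z $ j)))"

end

theory Submission
  imports Defs
begin

text \<open>Every proper convex piecewise linear-quadratic function is firmly convex, because a nonnegative
  convex quadratic on a polyhedron grows at least like the squared distance to its zero set, on
  bounded sets; this is applied piece by piece.

  For the node function, an optimal \<open>z\<close> equals \<open>1\<close> on a set \<open>A\<close> of free indices with the largest
  \<open>\<bar>\<beta> $ j\<bar>\<close> and is proportional to \<open>\<bar>\<beta> $ j\<bar>\<close> on the others, so on finitely many polyhedra the value is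
  half of \<open>\<Sum>j\<in>J1 \<union> A. (\<beta> $ j)\<^sup>2\<close> plus the squared \<open>1\<close>-norm of the remaining part divided by the remaining
  budget. Exchanging suprema, the conjugate is the sum over \<open>J1\<close> of the Huber functions of the \<open>\<alpha> $ j\<close>,
  plus the sum of the \<open>k - card J1\<close> largest ones over \<open>Jf\<close>.\<close>


section \<open>Quadratic growth on polyhedra\<close>

text \<open>The values of \<open>h\<close> on a piece constrain its matrix only along differences of
  points of that piece, so the matrix need not be positive semidefinite. The growth argument
  therefore uses convexity only as \<open>0 \<le> (x - y) \<bullet> T (x - y)\<close> for
  \<open>x\<close>, \<open>y\<close> in \<open>P\<close>. No description of the zero set by linear
  inequalities is computed: a compactness argument with projections onto it takes the place of an
  error bound, and finiteness of the constraint system keeps the limit direction feasible.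

  The two functions differ in where the optimal z lies. For fixed beta the cost is strictly curved
  in z, so fractional values share the budget. After the supremum over beta for fixed z, what
  remains is linear in z, and a 0/1 vector is optimal. This is why the conjugate needs no
  counterpart of the quotient by the remaining budget.\<close>

lemma quadratic_expand:
  fixes T :: "'a::euclidean_space \<Rightarrow> 'a"
  assumes "linear T" and sym: "\<And>x y. x \<bullet> T y = T x \<bullet> y"
    and q: "\<And>x. q x = 1/2 * (x \<bullet> T x) + b \<bullet> x + c"
  shows "q (y + s *\<^sub>R w) = q y + s * ((T y + b) \<bullet> w) + s\<^sup>2 / 2 * (w \<bullet> T w)"
proof -
  have "w \<bullet> T y = T y \<bullet> w" by (rule inner_commute)
  then show ?thesis
    by (simp add: q sym[of y w] linear_add[OF \<open>linear T\<close>] linear_scale[OF \<open>linear T\<close>] inner_simps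
        power2_eq_square) (simp add: field_simps)
qed

lemma convex_line_segmentD:
  fixes x y :: "'a::real_vector"
  assumes "convex P" "y \<in> P" "x \<in> P" "0 \<le> t" "t \<le> 1"
  shows "y + t *\<^sub>R (x - y) \<in> P"
  using convexD_alt[OF assms] by (simp add: algebra_simps)

lemma at_right_0_obtain:
  assumes "eventually P (at_right (0::real))"
  obtains e where "e > 0" "\<And>t. 0 < t \<Longrightarrow> t < e \<Longrightarrow> P t"
  using assms by (auto simp: eventually_at_right_field)

text \<open>Division by t followed by t tending to 0 isolates the first-order term. It serves as
  derivative test for \<open>q\<close> along a feasible direction and for the curvature form along a
  perturbed difference.\<close>

lemma affine_nonneg_near_0:
  fixes a b :: real
  assumes "eventually (\<lambda>t. 0 \<le> t * a + t\<^sup>2 * b) (at_right 0)"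
  shows "0 \<le> a"
proof -
  obtain e where e: "e > 0" "\<And>t. 0 < t \<Longrightarrow> t < e \<Longrightarrow> 0 \<le> t * a + t\<^sup>2 * b"
    using at_right_0_obtain[OF assms] by blast
  have ev: "eventually (\<lambda>t. 0 \<le> a + t * b) (at_right 0)"
    unfolding eventually_at_right_field
  proof (intro exI[of _ e] conjI allI impI)
    fix t :: real assume t: "0 < t" "t < e"
    have "0 \<le> t * (a + t * b)" using e(2)[OF t] by (simp add: algebra_simps power2_eq_square)
    then show "0 \<le> a + t * b" using t(1) by (simp add: zero_le_mult_iff)
  qed (use e in auto)
  have "((\<lambda>t. a + t * b) \<longlongrightarrow> a + 0 * b) (at_right 0)"
    by (intro tendsto_intros)
  from tendsto_lowerbound[OF this ev] show ?thesis by simp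
qed

text \<open>The limit \<open>u\<close> of the unit directions from \<open>y n\<close> to \<open>x n\<close> is a direction of zero growth that
  stays in the polyhedron, because the set of active constraints is constant along the sequence. So
  a short step from \<open>y n\<close> along \<open>u\<close> remains in the zero set, although \<open>u\<close> is a limit of its normals.\<close>

lemma no_slow_growth_sequence:
  fixes T :: "'a::euclidean_space \<Rightarrow> 'a" and H :: "'i set" and a :: "'i \<Rightarrow> 'a" and \<beta> :: "'i \<Rightarrow> real"
  assumes T: "linear T" "\<And>x y. x \<bullet> T y = T x \<bullet> y"
    and q: "\<And>x. q x = 1/2 * (x \<bullet> T x) + b \<bullet> x + c"
    and H: "finite H" and P: "P = {x. \<forall>h\<in>H. a h \<bullet> x \<le> \<beta> h}"
    and conv: "\<And>x y. x \<in> P \<Longrightarrow> y \<in> P \<Longrightarrow> 0 \<le> (x - y) \<bullet> T (x - y)"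
    and nonneg: "\<And>x. x \<in> P \<Longrightarrow> 0 \<le> q x"
    and y: "\<And>n. y n \<in> P" "\<And>n. q (y n) = 0"
    and act: "\<And>n. {h\<in>H. a h \<bullet> y n = \<beta> h} = I"
    and lim: "u \<longlonglongrightarrow> l" and norm: "\<And>n. norm (u n) = 1"
    and d: "\<And>n. 0 < d n" "\<And>n. d n \<le> D" and bdd: "bounded (range y)"
    and x: "\<And>n. y n + d n *\<^sub>R u n \<in> P"
    and slow: "\<And>n. q (y n + d n *\<^sub>R u n) \<le> (d n)\<^sup>2 / real (Suc n)"
    and normal: "\<And>n z. z \<in> P \<Longrightarrow> q z = 0 \<Longrightarrow> u n \<bullet> (z - y n) \<le> 0"
  shows False
proof -
  interpret T: bounded_linear T using T(1) by (simp add: linear_conv_bounded_linear)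
  note expand = quadratic_expand[OF T q]
  have "convex P"
    unfolding P Collect_ball_eq by (intro convex_INT) (simp add: convex_halfspace_le)
  \<comment> \<open>A constraint in \<open>I\<close> is tight at every \<open>y n\<close> and still
    holds at \<open>y n + d n *\<^sub>R u n\<close>, so its normal has a nonpositive product with
    each \<open>u n\<close>, hence with \<open>l\<close>.\<close>
  have feasible_dir: "a h \<bullet> l \<le> 0" if "h \<in> I" for h
  proof (rule tendsto_upperbound)
    show "(\<lambda>n. a h \<bullet> u n) \<longlonglongrightarrow> a h \<bullet> l" by (intro tendsto_intros lim)
    show "\<forall>\<^sub>F n in sequentially. a h \<bullet> u n \<le> 0"
    proof (rule always_eventually, rule allI)
      fix n
      have h: "h \<in> H" "a h \<bullet> y n = \<beta> h" using act[of n] that by auto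
      have "a h \<bullet> (y n + d n *\<^sub>R u n) \<le> \<beta> h" using x[of n] h P by auto
      then have "d n * (a h \<bullet> u n) \<le> 0" using h by (simp add: inner_simps)
      then show "a h \<bullet> u n \<le> 0" using d(1)[of n] by (simp add: mult_le_0_iff)
    qed
  qed simp
  \<comment> \<open>The constraints in \<open>I\<close> are handled by \<open>feasible_dir\<close>;
    the others have slack at \<open>y n\<close>, which absorbs a short step.\<close>
  have step: "\<forall>\<^sub>F t in at_right 0. y n + t *\<^sub>R l \<in> P" for n
    unfolding P mem_Collect_eq
  proof (intro eventually_ball_finite[OF H] ballI)
    fix h assume h: "h \<in> H"
    show "\<forall>\<^sub>F t in at_right 0. a h \<bullet> (y n + t *\<^sub>R l) \<le> \<beta> h"
    proof (cases "h \<in> I")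
      case True
      then have eq: "a h \<bullet> y n = \<beta> h" using act[of n] by auto
      have "a h \<bullet> (y n + t *\<^sub>R l) \<le> \<beta> h" if "t > 0" for t
        using that feasible_dir[OF True] eq by (simp add: inner_simps mult_nonneg_nonpos)
      then show ?thesis by (auto simp: eventually_at_right_field intro: exI[of _ 1])
    next
      case False
      then have lt: "a h \<bullet> y n < \<beta> h" using act[of n] h y(1)[of n] P by force
      have "((\<lambda>t. a h \<bullet> (y n + t *\<^sub>R l)) \<longlongrightarrow> a h \<bullet> (y n + 0 *\<^sub>R l)) (at_right 0)"
        by (intro tendsto_intros)
      then have "\<forall>\<^sub>F t in at_right 0. a h \<bullet> (y n + t *\<^sub>R l) < \<beta> h"
        using lt by (intro order_tendstoD) auto
      then show ?thesis by eventually_elim simp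
    qed
  qed
  have step': "\<forall>\<^sub>F t in at_right 0. y n + t *\<^sub>R u n \<in> P" for n
    unfolding eventually_at_right_field
  proof (intro exI[of _ "d n"] conjI d allI impI)
    fix t assume t: "0 < t" "t < d n"
    have "y n + (t / d n) *\<^sub>R ((y n + d n *\<^sub>R u n) - y n) \<in> P"
      by (rule convex_line_segmentD[OF \<open>convex P\<close> y(1) x]) (use t in auto)
    then show "y n + t *\<^sub>R u n \<in> P" using t by simp
  qed
  have slope: "0 \<le> (T (y n) + b) \<bullet> u n" for n
  proof (rule affine_nonneg_near_0)
    show "\<forall>\<^sub>F t in at_right 0. 0 \<le> t * ((T (y n) + b) \<bullet> u n) + t\<^sup>2 * (1/2 * (u n \<bullet> T (u n)))"
      using step'[of n]
    proof eventually_elim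
      case (elim t)
      from nonneg[OF this] show ?case by (simp add: expand y)
    qed
  qed
  have curv: "0 \<le> u n \<bullet> T (u n)" for n
  proof -
    have "0 \<le> (d n)\<^sup>2 * (u n \<bullet> T (u n))"
      using conv[OF x y(1), of n n] by (simp add: T.scaleR power2_eq_square)
    then show ?thesis using d(1)[of n] by (simp add: zero_le_mult_iff)
  qed
  have curv_le: "u n \<bullet> T (u n) \<le> 2 / real (Suc n)"
    and slope_le: "(T (y n) + b) \<bullet> u n \<le> D / real (Suc n)" for n
  proof -
    have e: "d n * ((T (y n) + b) \<bullet> u n) + (d n)\<^sup>2 / 2 * (u n \<bullet> T (u n)) \<le> (d n)\<^sup>2 / real (Suc n)"
      using slow[of n] by (simp add: expand y)
    have "(d n)\<^sup>2 / 2 * (u n \<bullet> T (u n)) \<le> (d n)\<^sup>2 / real (Suc n)"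
      using e mult_nonneg_nonneg[OF less_imp_le[OF d(1)] slope, of n n] by linarith
    then have "(d n)\<^sup>2 * (u n \<bullet> T (u n)) \<le> (d n)\<^sup>2 * (2 / real (Suc n))" by simp
    then show "u n \<bullet> T (u n) \<le> 2 / real (Suc n)"
      using d(1)[of n] by (subst (asm) mult_le_cancel_left_pos) auto
    have "0 \<le> (d n)\<^sup>2 / 2 * (u n \<bullet> T (u n))" using curv[of n] by simp
    then have "d n * ((T (y n) + b) \<bullet> u n) \<le> d n * (d n / real (Suc n))"
      using e by (simp add: power2_eq_square)
    then have "(T (y n) + b) \<bullet> u n \<le> d n / real (Suc n)"
      using d(1)[of n] by (subst (asm) mult_le_cancel_left_pos) auto
    also have "\<dots> \<le> D / real (Suc n)" using d(2)[of n] by (intro divide_right_mono) auto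
    finally show "(T (y n) + b) \<bullet> u n \<le> D / real (Suc n)" .
  qed
  have lTl: "l \<bullet> T l = 0"
  proof -
    have "(\<lambda>n. u n \<bullet> T (u n)) \<longlonglongrightarrow> l \<bullet> T l" by (intro tendsto_intros T.tendsto lim)
    moreover have "(\<lambda>n. u n \<bullet> T (u n)) \<longlonglongrightarrow> 0"
      by (rule tendsto_sandwich[where f = "\<lambda>_. 0" and h = "\<lambda>n. 2 / real (Suc n)"])
        (use curv curv_le LIMSEQ_Suc[OF lim_const_over_n] in simp_all)
    ultimately show ?thesis by (rule LIMSEQ_unique)
  qed
  \<comment> \<open>Used in both orders of \<open>n\<close> and \<open>m\<close>, this gives 0, so
    the slope of \<open>q\<close> along \<open>l\<close> is the same at every \<open>y n\<close>.
    The curvature form vanishes on \<open>y n - y m\<close> and on \<open>l\<close> and is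
    nonnegative on \<open>y n + t *\<^sub>R l - y m\<close>, which fixes the sign of the mixed
    term.\<close>
  have ge: "0 \<le> (y n - y m) \<bullet> T l" for n m
  proof -
    let ?w = "y n - y m"
    \<comment> \<open>A quadratic vanishing at both ends of a segment has minus one eighth of its
      curvature as midpoint value.\<close>
    have "?w \<bullet> T ?w \<le> 0"
    proof -
      have "0 \<le> q (y m + (1/2) *\<^sub>R ?w)"
        by (intro nonneg convex_line_segmentD \<open>convex P\<close> y) auto
      moreover have "q (y m + 1 *\<^sub>R ?w) = 0" by (simp add: y)
      ultimately show ?thesis unfolding expand by (simp add: y power2_eq_square)
    qed
    then have wTw: "?w \<bullet> T ?w = 0" using conv[OF y(1) y(1)] by (meson antisym)
    have "0 \<le> 2 * (?w \<bullet> T l)"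
    proof (rule affine_nonneg_near_0)
      show "\<forall>\<^sub>F t in at_right 0. 0 \<le> t * (2 * (?w \<bullet> T l)) + t\<^sup>2 * (l \<bullet> T l)"
        using step[of n]
      proof eventually_elim
        case (elim t)
        have "0 \<le> (?w + t *\<^sub>R l) \<bullet> T (?w + t *\<^sub>R l)"
          using conv[OF elim y(1)[of m]] by (simp add: algebra_simps)
        also have "\<dots> = ?w \<bullet> T ?w + t * (2 * (?w \<bullet> T l)) + t\<^sup>2 * (l \<bullet> T l)"
          using T(2)[of ?w l]
          by (simp only: T.add T.scaleR inner_add_left inner_add_right inner_scaleR_left inner_scaleR_right
              inner_commute[of l "T ?w"] power2_eq_square) (simp add: algebra_simps)
        finally show ?case using wTw by simp
      qed
    qed
    then show ?thesis by simp
  qed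
  define \<delta> where "\<delta> = (T (y 0) + b) \<bullet> l"
  have \<delta>: "(T (y n) + b) \<bullet> l = \<delta>" for n
  proof -
    have "(y n - y 0) \<bullet> T l = 0" using ge[of n 0] ge[of 0 n] by (simp add: inner_diff_left)
    then show ?thesis by (simp add: \<delta>_def inner_add_left inner_diff_left T(2) T.diff)
  qed
  \<comment> \<open>The gradients at \<open>y n\<close> need not converge, but they are bounded.
    Their products with \<open>u n - l\<close> therefore tend to 0, and the slopes along
    \<open>u n\<close>, at most \<open>D / real (Suc n)\<close>, converge to
    \<open>\<delta>\<close>.\<close>
  have "\<delta> \<le> 0"
  proof (rule tendsto_le[OF sequentially_bot])
    have "bounded (range (\<lambda>n. T (y n) + b))"
    proof -
      have "bounded (T ` range y)" using bdd by (rule bounded_linear_image) (rule T.bounded_linear_axioms)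
      then have "bounded ((\<lambda>z. b + z) ` (T ` range y))" by (rule bounded_translation)
      then show ?thesis by (simp add: image_image add.commute)
    qed
    then have "Bfun (\<lambda>n. T (y n) + b) sequentially" by (simp add: Bseq_eq_bounded)
    moreover have "Zfun (\<lambda>n. u n - l) sequentially" using lim by (simp add: tendsto_Zfun_iff)
    ultimately have "Zfun (\<lambda>n. (T (y n) + b) \<bullet> (u n - l)) sequentially"
      by (intro bounded_bilinear.Bfun_prod_Zfun[OF bounded_bilinear_inner])
    then show "(\<lambda>n. (T (y n) + b) \<bullet> u n) \<longlonglongrightarrow> \<delta>"
      by (simp add: tendsto_Zfun_iff inner_diff_right \<delta>)
    show "(\<lambda>n. D / real (Suc n)) \<longlonglongrightarrow> 0" by (rule LIMSEQ_Suc[OF lim_const_over_n])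
  qed (use slope_le in simp)
  \<comment> \<open>Along \<open>l\<close> the curvature is 0 and the slope at most 0, so
    nonnegativity makes \<open>q\<close> vanish on the short step and \<open>normal\<close> applies
    to its endpoint.\<close>
  have ul: "u n \<bullet> l \<le> 0" for n
  proof -
    obtain e where e: "e > 0" "\<And>t. 0 < t \<Longrightarrow> t < e \<Longrightarrow> y n + t *\<^sub>R l \<in> P"
      using at_right_0_obtain[OF step] by blast
    define t where "t = e / 2"
    have t: "t > 0" "y n + t *\<^sub>R l \<in> P" using e by (auto simp: t_def)
    have "q (y n + t *\<^sub>R l) = t * \<delta>" by (simp add: expand y lTl \<delta>)
    moreover have "t * \<delta> \<le> 0" using t(1) \<open>\<delta> \<le> 0\<close> by (simp add: mult_nonneg_nonpos)
    ultimately have "q (y n + t *\<^sub>R l) = 0" using nonneg[OF t(2)] by linarith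
    from normal[OF t(2) this, of n] t(1) show ?thesis by (simp add: mult_le_0_iff)
  qed
  have "(\<lambda>n. u n \<bullet> l) \<longlonglongrightarrow> l \<bullet> l" by (intro tendsto_intros lim)
  then have "l \<bullet> l \<le> 0" using ul by (intro LIMSEQ_le_const2) auto
  moreover have "norm l = 1" using tendsto_norm[OF lim] norm by (simp add: LIMSEQ_const_iff)
  ultimately show False by (simp add: dot_square_norm)
qed

text \<open>If every constant \<open>1 / real (Suc n)\<close> fails, join the offending points to
  their projections on the zero set. There are finitely many active sets and the unit sphere is
  compact, so a subsequence has a constant active set and convergent unit directions, which
  \<open>no_slow_growth_sequence\<close> excludes.\<close>

lemma quadratic_growth_polyhedron:
  fixes T :: "'a::euclidean_space \<Rightarrow> 'a"
  assumes T: "linear T" "\<And>x y. x \<bullet> T y = T x \<bullet> y"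
    and q: "\<And>x. q x = 1/2 * (x \<bullet> T x) + b \<bullet> x + c"
    and P: "polyhedron P"
    and conv: "\<And>x y. x \<in> P \<Longrightarrow> y \<in> P \<Longrightarrow> 0 \<le> (x - y) \<bullet> T (x - y)"
    and nonneg: "\<And>x. x \<in> P \<Longrightarrow> 0 \<le> q x"
    and ne: "{x\<in>P. q x = 0} \<noteq> {}" and K: "bounded K"
  obtains \<kappa> where "\<kappa> > 0" "\<And>x. x \<in> P \<Longrightarrow> x \<in> K \<Longrightarrow> \<kappa> * (infdist x {x\<in>P. q x = 0})\<^sup>2 \<le> q x"
proof -
  interpret T: bounded_linear T using T(1) by (simp add: linear_conv_bounded_linear)
  note expand = quadratic_expand[OF T q]
  define F where "F = {x\<in>P. q x = 0}"
  have "continuous_on UNIV q" unfolding q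
    by (intro continuous_intros linear_continuous_on T.bounded_linear_axioms)
  have "F \<noteq> {}" using ne F_def by simp
  have "closed F"
  proof -
    have "closed (P \<inter> q -` {0})"
      using continuous_on_subset[OF \<open>continuous_on UNIV q\<close>] polyhedron_imp_closed[OF P]
      by (intro continuous_closed_preimage) auto
    then show ?thesis by (simp add: F_def vimage_def Int_def)
  qed
  have "convex F"
  proof (rule convexI)
    fix x y and s t :: real assume *: "x \<in> F" "y \<in> F" "0 \<le> s" "0 \<le> t" "s + t = 1"
    have in_P: "s *\<^sub>R x + t *\<^sub>R y \<in> P"
      using * convexD[OF polyhedron_imp_convex[OF P]] by (auto simp: F_def)
    have s: "s = 1 - t" using * by simp
    have "q (x + 1 *\<^sub>R (y - x)) = 0" using * by (simp add: F_def)
    \<comment> \<open>Vanishing at both ends ties the slope to the curvature. The value in between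
      is then a nonpositive multiple of the curvature, hence 0 by nonnegativity of
      \<open>q\<close>.\<close>
    then have g: "(T x + b) \<bullet> (y - x) = - (1/2 * ((y - x) \<bullet> T (y - x)))"
      unfolding expand using * by (simp add: F_def)
    have "q (s *\<^sub>R x + t *\<^sub>R y) = q (x + t *\<^sub>R (y - x))"
      by (simp add: s algebra_simps)
    also have "\<dots> = - (t * s / 2 * ((y - x) \<bullet> T (y - x)))"
    proof -
      have "t * - (1/2 * m) + t\<^sup>2 / 2 * m = - (t * s / 2 * m)" for m
        by (simp add: s power2_eq_square algebra_simps add_divide_distrib diff_divide_distrib)
      moreover have "q x = 0" using * by (simp add: F_def)
      ultimately show ?thesis unfolding expand g by simp
    qed
    also have "\<dots> \<le> 0" using * conv[of y x] by (simp add: F_def)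
    finally have "q (s *\<^sub>R x + t *\<^sub>R y) = 0" using nonneg[OF in_P] by simp
    with in_P show "s *\<^sub>R x + t *\<^sub>R y \<in> F" by (simp add: F_def)
  qed
  obtain H where H: "finite H" "P = \<Inter> H"
    and halfspace: "\<forall>h\<in>H. \<exists>a \<beta>. a \<noteq> 0 \<and> h = {x. a \<bullet> x \<le> \<beta>}"
    using P unfolding polyhedron_def by blast
  obtain a \<beta> where ab: "\<And>h. h \<in> H \<Longrightarrow> h = {x. a h \<bullet> x \<le> \<beta> h}"
    using halfspace by metis
  have P_eq: "P = {x. \<forall>h\<in>H. a h \<bullet> x \<le> \<beta> h}" using ab H(2) by blast
  have "\<exists>\<kappa>>0. \<forall>x. x \<in> P \<longrightarrow> x \<in> K \<longrightarrow> \<kappa> * (infdist x F)\<^sup>2 \<le> q x"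
  proof (rule ccontr)
    assume "\<not> ?thesis"
    then have "\<forall>n. \<exists>x. x \<in> P \<and> x \<in> K \<and> q x < 1 / real (Suc n) * (infdist x F)\<^sup>2"
      by (smt (verit) divide_pos_pos of_nat_0_less_iff zero_less_Suc)
    then obtain x where x: "\<And>n. x n \<in> P" "\<And>n. x n \<in> K" "\<And>n. q (x n) < 1 / real (Suc n) * (infdist (x n) F)\<^sup>2"
      by metis
    define y where "y n = closest_point F (x n)" for n
    define d where "d n = dist (x n) (y n)" for n
    define u where "u n = (x n - y n) /\<^sub>R d n" for n
    have yF: "y n \<in> F" for n unfolding y_def
      by (rule closest_point_in_set) fact+
    have d_eq: "infdist (x n) F = d n" for n
      using setdist_closest_point[OF \<open>closed F\<close> \<open>F \<noteq> {}\<close>] by (simp add: infdist_eq_setdist d_def y_def)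
    have dpos: "d n > 0" for n
    proof -
      have "0 < 1 / real (Suc n) * (d n)\<^sup>2" using x(3)[of n] nonneg[OF x(1)] unfolding d_eq by (meson le_less_trans)
      then show ?thesis by (auto simp: d_def)
    qed
    have xeq: "x n = y n + d n *\<^sub>R u n" for n using dpos[of n] by (simp add: u_def)
    have normu: "norm (u n) = 1" for n using dpos[of n] by (simp add: u_def d_def dist_norm)
    obtain z0 where z0: "z0 \<in> F" using \<open>F \<noteq> {}\<close> by blast
    obtain B where B: "\<And>n. dist (x n) z0 \<le> B"
      using K x(2) unfolding bounded_any_center[of K z0] by (metis dist_commute)
    have dB: "d n \<le> B" for n
      using closest_point_le[OF \<open>closed F\<close> z0, of "x n"] B[of n] by (simp add: d_def y_def)
    have "bounded (range y)"
      unfolding bounded_any_center[of _ z0]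
    proof (intro exI[of _ "B + B"] ballI)
      fix w assume "w \<in> range y"
      then obtain n where "w = y n" by blast
      then show "dist z0 w \<le> B + B"
        using B[of n] dB[of n] dist_triangle[of z0 "y n" "x n"] by (simp add: d_def dist_commute)
    qed
    define act where "act n = {h\<in>H. a h \<bullet> y n = \<beta> h}" for n
    have "finite (range act)" by (rule finite_subset[of _ "Pow H"]) (auto simp: act_def H)
    then obtain n0 where "infinite {n\<in>UNIV. act n = act n0}"
      using pigeonhole_infinite[of "UNIV :: nat set" act] by auto
    then obtain r :: "nat \<Rightarrow> nat" where r: "strict_mono r" "\<And>n. act (r n) = act n0"
      using infinite_enumerate[of "{n\<in>UNIV. act n = act n0}"] by blast
    have "compact (sphere (0::'a) 1)" by simp
    moreover have "\<forall>n. (u \<circ> r) n \<in> sphere 0 1" using normu by simp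
    ultimately obtain l s where s: "strict_mono s" "((u \<circ> r) \<circ> s) \<longlonglongrightarrow> l"
      unfolding compact_def by meson
    define k where "k = r \<circ> s"
    have "strict_mono k" unfolding k_def by (intro strict_mono_o r s)
    show False
    proof (rule no_slow_growth_sequence[OF T q H(1) P_eq conv nonneg, where y = "y \<circ> k" and u = "u \<circ> k"
          and d = "d \<circ> k" and I = "act n0" and l = l and D = B])
      show "{h\<in>H. a h \<bullet> (y \<circ> k) n = \<beta> h} = act n0" for n
        using r(2)[of "s n"] by (simp add: act_def k_def)
      show "(u \<circ> k) \<longlonglongrightarrow> l" using s(2) by (simp add: k_def o_assoc)
      show "bounded (range (y \<circ> k))" by (rule bounded_subset[OF \<open>bounded (range y)\<close>]) auto
      show "q ((y \<circ> k) n + (d \<circ> k) n *\<^sub>R (u \<circ> k) n) \<le> ((d \<circ> k) n)\<^sup>2 / real (Suc n)" for n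
      proof -
        have "q (x (k n)) \<le> (d (k n))\<^sup>2 / real (Suc (k n))"
          using x(3)[of "k n"] by (simp add: d_eq)
        \<comment> \<open>Re-indexing only weakens the bound, because
          \<open>n \<le> k n\<close>.\<close>
        also have "\<dots> \<le> (d (k n))\<^sup>2 / real (Suc n)"
          using strict_mono_imp_increasing[OF \<open>strict_mono k\<close>, of n] by (intro divide_left_mono) auto
        finally show ?thesis by (simp add: xeq[symmetric])
      qed
      show "(u \<circ> k) n \<bullet> (z - (y \<circ> k) n) \<le> 0" if "z \<in> P" "q z = 0" for n z
      proof -
        have "(x (k n) - y (k n)) \<bullet> (z - y (k n)) \<le> 0" unfolding y_def
          by (rule closest_point_dot) (use that \<open>convex F\<close> \<open>closed F\<close> in \<open>auto simp: F_def\<close>)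
        then show ?thesis using dpos[of "k n"] by (simp add: u_def mult_le_0_iff)
      qed
    qed (use yF normu dpos dB x(1) in \<open>auto simp: F_def xeq[symmetric]\<close>)
  qed
  then show thesis using that unfolding F_def by blast
qed


section \<open>Firm convexity of convex PLQ functions\<close>

lemma plq_obtain:
  assumes "plq h"
  obtains \<P> Q b c where "finite \<P>" "dom_of h = \<Union>\<P>" "\<forall>P\<in>\<P>. polyhedron P"
    "\<forall>P\<in>\<P>. transpose (Q P) = Q P"
    "\<forall>P\<in>\<P>. \<forall>\<beta>\<in>P. h \<beta> = ereal (1/2 * (\<beta> \<bullet> (Q P *v \<beta>)) + b P \<bullet> \<beta> + c P)"
proof -
  obtain \<P> where \<P>: "finite \<P>" "dom_of h = \<Union>\<P>" "\<forall>P\<in>\<P>. polyhedron P \<and>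
      (\<exists>(Q :: real^'a^'a) b c. transpose Q = Q \<and>
        (\<forall>\<beta>\<in>P. h \<beta> = ereal (1/2 * (\<beta> \<bullet> (Q *v \<beta>)) + b \<bullet> \<beta> + c)))"
    using assms unfolding plq_def by (elim exE conjE)
  then have "\<forall>P\<in>\<P>. \<exists>(Q :: real^'a^'a) b c. transpose Q = Q \<and>
      (\<forall>\<beta>\<in>P. h \<beta> = ereal (1/2 * (\<beta> \<bullet> (Q *v \<beta>)) + b \<bullet> \<beta> + c))"
    unfolding ball_conj_distrib by (elim conjE)
  then obtain Q :: "(real^'a) set \<Rightarrow> real^'a^'a" and b c where
    "\<forall>P\<in>\<P>. transpose (Q P) = Q P \<and>
      (\<forall>\<beta>\<in>P. h \<beta> = ereal (1/2 * (\<beta> \<bullet> (Q P *v \<beta>)) + b P \<bullet> \<beta> + c P))"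
    unfolding bchoice_iff by (elim exE)
  with \<P> show thesis unfolding ball_conj_distrib by (elim conjE) (rule that)
qed

lemma symmetric_matrix_inner:
  fixes Q :: "real^'n^'n"
  assumes "transpose Q = Q"
  shows "x \<bullet> (Q *v y) = (Q *v x) \<bullet> y"
  by (metis assms dot_lmul_matrix transpose_matrix_vector)

text \<open>Over each piece the epigraph is the part of a closed cylinder cut out by a continuous
  inequality, and there are finitely many pieces.\<close>

lemma plq_closed:
  assumes "plq h"
  shows "closed_fun h"
proof -
  obtain \<P> Q b c where \<P>: "finite \<P>" "dom_of h = \<Union>\<P>" "\<forall>P\<in>\<P>. polyhedron P"
    and "\<forall>P\<in>\<P>. transpose (Q P) = Q P"
    and h: "\<forall>P\<in>\<P>. \<forall>\<beta>\<in>P. h \<beta> = ereal (1/2 * (\<beta> \<bullet> (Q P *v \<beta>)) + b P \<bullet> \<beta> + c P)"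
    using assms by (rule plq_obtain)
  have "epi h = (\<Union>P\<in>\<P>. (P \<times> UNIV) \<inter>
      {w. 1/2 * (fst w \<bullet> (Q P *v fst w)) + b P \<bullet> fst w + c P \<le> snd w})" (is "_ = (\<Union>P\<in>\<P>. ?E P)")
  proof (intro equalityI subsetI)
    fix w assume w: "w \<in> epi h"
    obtain \<beta> t where [simp]: "w = (\<beta>, t)" by (cases w)
    have "h \<beta> \<le> ereal t" using w by (simp add: epi_def)
    then have "h \<beta> < \<infinity>" by (rule le_less_trans) simp
    then obtain P where "P \<in> \<P>" "\<beta> \<in> P" using \<P>(2) by (auto simp: dom_of_def)
    then show "w \<in> (\<Union>P\<in>\<P>. ?E P)" using \<open>h \<beta> \<le> ereal t\<close> h by auto
  qed (use h in \<open>auto simp: epi_def\<close>)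
  moreover have "closed (?E P)" if "P \<in> \<P>" for P
    using \<P>(3) that by (intro closed_Int closed_Times polyhedron_imp_closed closed_Collect_le
        continuous_intros bounded_linear.continuous_on[OF matrix_vector_mul_bounded_linear]) auto
  ultimately show ?thesis unfolding closed_fun_def using \<P>(1) by auto
qed

text \<open>Midpoints suffice later: a quadratic satisfying the midpoint inequality for two points
  has nonnegative curvature along their difference.\<close>

lemma convex_fun_midpoint:
  assumes "convex_fun h" "h x = ereal s" "h y = ereal t"
  shows "h ((1/2) *\<^sub>R x + (1/2) *\<^sub>R y) \<le> ereal (1/2 * s + 1/2 * t)"
proof -
  have "(x, s) \<in> epi h" "(y, t) \<in> epi h" using assms by (auto simp: epi_def)
  then have "(1/2) *\<^sub>R (x, s) + (1/2) *\<^sub>R (y, t) \<in> epi h"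
    using assms(1) unfolding convex_fun_def by (intro convexD) auto
  then show ?thesis by (simp add: epi_def)
qed

text \<open>Because \<open>f\<close> is nonnegative, a constant may be decreased, so the minimum
  over the pieces works for all of them.\<close>

lemma finite_uniform_constant:
  assumes "finite A" and "\<And>P. P \<in> A \<Longrightarrow> \<exists>\<kappa>>0::real. \<forall>x. R P x \<longrightarrow> \<kappa> * f x \<le> g x"
    and "\<And>x. 0 \<le> (f x :: real)"
  shows "\<exists>\<kappa>>0. \<forall>P\<in>A. \<forall>x. R P x \<longrightarrow> \<kappa> * f x \<le> g x"
  using assms(1,2)
proof (induction A rule: finite_induct)
  case empty
  then show ?case by (auto intro: exI[of _ 1])
next
  case (insert P A)
  have "\<exists>\<kappa>>0. \<forall>x. R P x \<longrightarrow> \<kappa> * f x \<le> g x" by (rule insert.prems) simp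
  then obtain \<kappa> where \<kappa>: "\<kappa> > 0" "\<And>x. R P x \<Longrightarrow> \<kappa> * f x \<le> g x" by auto
  have "\<exists>\<kappa>>0. \<forall>P\<in>A. \<forall>x. R P x \<longrightarrow> \<kappa> * f x \<le> g x" by (rule insert.IH, rule insert.prems) simp
  then obtain \<kappa>' where \<kappa>': "\<kappa>' > 0" "\<And>P x. P \<in> A \<Longrightarrow> R P x \<Longrightarrow> \<kappa>' * f x \<le> g x" by auto
  have min: "min \<kappa> \<kappa>' * f x \<le> \<kappa> * f x" "min \<kappa> \<kappa>' * f x \<le> \<kappa>' * f x" for x
    using assms(3)[of x] by (auto intro: mult_right_mono)
  have "min \<kappa> \<kappa>' * f x \<le> g x" if "P' \<in> insert P A" "R P' x" for P' x
  proof (cases "P' = P")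
    case True
    then show ?thesis using min(1)[of x] \<kappa>(2)[of x] that by simp
  next
    case False
    then show ?thesis using min(2)[of x] \<kappa>'(2)[of P' x] that by simp
  qed
  then show ?case using \<kappa>(1) \<kappa>'(1) by (intro exI[of _ "min \<kappa> \<kappa>'"]) simp
qed

text \<open>On a piece that meets the set \<open>S\<close> of minimizers, growth holds for the
  distance to \<open>P \<inter> S\<close>, which is at least the distance to \<open>S\<close>. On a
  piece that misses \<open>S\<close>, compactness of \<open>K \<inter> P\<close> bounds the excess
  over the minimum below and the distance above.\<close>

theorem plq_convex_imp_firmly_convex:
  assumes plq: "plq h" and conv: "convex_fun h" and proper: "proper_fun h"
  shows "firmly_convex h"
proof -
  have closed: "closed_fun h" using plq by (rule plq_closed)
  obtain \<P> Q b c where \<P>: "finite \<P>" "dom_of h = \<Union>\<P>" and poly: "\<forall>P\<in>\<P>. polyhedron P"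
    and sym: "\<forall>P\<in>\<P>. transpose (Q P) = Q P"
    and h: "\<forall>P\<in>\<P>. \<forall>\<beta>\<in>P. h \<beta> = ereal (1/2 * (\<beta> \<bullet> (Q P *v \<beta>)) + b P \<bullet> \<beta> + c P)"
    using plq by (rule plq_obtain)
  have "firmly_convex_rel h \<nu>" if ne: "subdifferential_inv (tilt h \<nu>) 0 \<noteq> {}" for \<nu>
  proof -
    define S where "S = subdifferential_inv (tilt h \<nu>) 0"
    obtain x0 where x0: "x0 \<in> S" using ne S_def by blast
    have S: "x \<in> S \<longleftrightarrow> (\<forall>y. tilt h \<nu> x \<le> tilt h \<nu> y)" for x
      unfolding S_def subdifferential_inv_0_eq_minimizers by simp
    obtain w where "h w \<noteq> \<infinity>" using proper unfolding proper_fun_def by blast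
    then have "tilt h \<nu> w < \<infinity>" by (cases "h w") (auto simp: tilt_def)
    moreover have "tilt h \<nu> x0 \<le> tilt h \<nu> w" using x0 S by blast
    ultimately have "tilt h \<nu> x0 < \<infinity>" by (meson le_less_trans)
    moreover have "tilt h \<nu> x0 \<noteq> -\<infinity>"
      using proper unfolding proper_fun_def tilt_def by (cases "h x0") auto
    ultimately obtain m where m: "tilt h \<nu> x0 = ereal m" by (cases "tilt h \<nu> x0") auto
    have Sm: "x \<in> S \<longleftrightarrow> tilt h \<nu> x = ereal m" for x
      using S x0 m by (metis order_antisym)
    have ge_m: "ereal m \<le> tilt h \<nu> x" for x using S x0 m by metis
    have inf_m: "(INF \<gamma>. tilt h \<nu> \<gamma>) = ereal m"
      using ge_m m by (intro antisym INF_greatest) (auto intro: INF_lower2[of x0])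
    \<comment> \<open>Tilt and minimal value are absorbed into the coefficients, so that
      \<open>q P\<close> is nonnegative on \<open>P\<close> and its zeros there are exactly
      \<open>P \<inter> S\<close>.\<close>
    define q where "q P x = 1/2 * (x \<bullet> (Q P *v x)) + (b P - \<nu>) \<bullet> x + (c P - m)" for P x
    have tq: "tilt h \<nu> x = ereal (m + q P x)" if "P \<in> \<P>" "x \<in> P" for P x
      using h that by (simp add: tilt_def q_def inner_diff_left)
    have "\<exists>\<kappa>>0. \<forall>x\<in>K. tilt h \<nu> x \<ge> ereal m + ereal (\<kappa> / 2 * (infdist x S)\<^sup>2)"
      if K: "compact K" for K
    proof -
      have "\<exists>\<kappa>>0. \<forall>x. x \<in> P \<and> x \<in> K \<longrightarrow> \<kappa> * (infdist x S)\<^sup>2 \<le> real_of_ereal (tilt h \<nu> x) - m"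
        if P: "P \<in> \<P>" for P
      proof -
        have nonneg: "0 \<le> q P x" if "x \<in> P" for x using ge_m[of x] tq[OF P that] by simp
        have zero: "{x\<in>P. q P x = 0} = P \<inter> S" using Sm tq[OF P] by auto
        have contq: "continuous_on UNIV (q P)" unfolding q_def
          by (intro continuous_intros bounded_linear.continuous_on[OF matrix_vector_mul_bounded_linear])
        have "\<exists>\<kappa>>0. \<forall>x. x \<in> P \<and> x \<in> K \<longrightarrow> \<kappa> * (infdist x S)\<^sup>2 \<le> q P x"
        proof (cases "P \<inter> S = {}")
          case True
          show ?thesis
          proof (cases "K \<inter> P = {}")
            case True
            then show ?thesis by (intro exI[of _ 1]) auto
          next
            case False
            have comp: "compact (K \<inter> P)"
              using K polyhedron_imp_closed[OF bspec[OF poly P]] by (rule compact_Int_closed)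
            obtain v where v: "v \<in> K \<inter> P" "\<And>x. x \<in> K \<inter> P \<Longrightarrow> q P v \<le> q P x"
              using continuous_attains_inf[OF comp False continuous_on_subset[OF contq]] by auto
            have "q P v \<noteq> 0" using v(1) True zero by blast
            then have pos: "q P v > 0" using nonneg[of v] v(1) by auto
            have "continuous_on (K \<inter> P) (\<lambda>x. (infdist x S)\<^sup>2)" by (intro continuous_intros)
            then obtain w where w: "\<And>x. x \<in> K \<inter> P \<Longrightarrow> (infdist x S)\<^sup>2 \<le> (infdist w S)\<^sup>2"
              using continuous_attains_sup[OF comp False] by blast
            define B where "B = (infdist w S)\<^sup>2 + 1"
            have "B > 0" unfolding B_def by (rule add_nonneg_pos) auto
            have "q P v / B * (infdist x S)\<^sup>2 \<le> q P x" if "x \<in> P" "x \<in> K" for x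
            proof -
              have "q P v / B * (infdist x S)\<^sup>2 \<le> q P v / B * B"
                using w[of x] that pos \<open>B > 0\<close> by (intro mult_left_mono) (auto simp: B_def)
              also have "\<dots> = q P v" using \<open>B > 0\<close> by simp
              also have "\<dots> \<le> q P x" using v(2) that by blast
              finally show ?thesis .
            qed
            then show ?thesis using pos \<open>B > 0\<close> by (intro exI[of _ "q P v / B"]) auto
          qed
        next
          case False
          have convq: "0 \<le> (x - y) \<bullet> (Q P *v (x - y))" if "x \<in> P" "y \<in> P" for x y
          proof -
            note expand = quadratic_expand[OF matrix_vector_mul_linear symmetric_matrix_inner[OF bspec[OF sym P]] q_def[of P]]
            define z where "z = (1/2) *\<^sub>R x + (1/2) *\<^sub>R y"
            have "z \<in> P" unfolding z_def
              using convexD[OF polyhedron_imp_convex[OF bspec[OF poly P]] that] by simp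
            have hq: "h w = ereal (q P w + m + \<nu> \<bullet> w)" if "w \<in> P" for w
              using h P that by (simp add: q_def inner_diff_left)
            have "h z \<le> ereal (1/2 * (q P x + m + \<nu> \<bullet> x) + 1/2 * (q P y + m + \<nu> \<bullet> y))"
              unfolding z_def by (rule convex_fun_midpoint[OF conv]) (use hq that in auto)
            then have "q P z \<le> 1/2 * q P x + 1/2 * q P y"
              unfolding hq[OF \<open>z \<in> P\<close>] by (simp add: z_def inner_add_right add_divide_distrib)
            moreover have "z = y + (1/2) *\<^sub>R (x - y)"
            proof -
              have "y + t *\<^sub>R (x - y) = (1 - t) *\<^sub>R y + t *\<^sub>R x" for t by (simp add: algebra_simps)
              from this[of "1/2"] show ?thesis by (simp add: z_def)
            qed
            moreover have "x = y + 1 *\<^sub>R (x - y)" by simp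
            ultimately have "q P (y + (1/2) *\<^sub>R (x - y)) \<le> 1/2 * q P (y + 1 *\<^sub>R (x - y)) + 1/2 * q P y"
              by metis
            then show ?thesis unfolding expand by (simp add: power2_eq_square field_simps)
          qed
          obtain \<kappa> where \<kappa>: "\<kappa> > 0"
            "\<And>x. x \<in> P \<Longrightarrow> x \<in> K \<Longrightarrow> \<kappa> * (infdist x {x\<in>P. q P x = 0})\<^sup>2 \<le> q P x"
            using quadratic_growth_polyhedron[OF matrix_vector_mul_linear symmetric_matrix_inner[OF bspec[OF sym P]]
                q_def[of P] bspec[OF poly P] convq nonneg _ compact_imp_bounded[OF K]] False zero by auto
          have "\<kappa> * (infdist x S)\<^sup>2 \<le> q P x" if "x \<in> P" "x \<in> K" for x
          proof -
            have "infdist x S \<le> infdist x {x\<in>P. q P x = 0}"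
              using False zero by (intro infdist_mono) auto
            then have "\<kappa> * (infdist x S)\<^sup>2 \<le> \<kappa> * (infdist x {x\<in>P. q P x = 0})\<^sup>2"
              using \<kappa>(1) by (intro mult_left_mono power_mono infdist_nonneg) auto
            then show ?thesis using \<kappa>(2)[OF that] by linarith
          qed
          then show ?thesis using \<kappa>(1) by blast
        qed
        then show ?thesis using tq[OF P] by auto
      qed
      from finite_uniform_constant[OF \<P>(1), of "\<lambda>P x. x \<in> P \<and> x \<in> K", OF this]
      obtain \<kappa> where \<kappa>: "\<kappa> > 0" "\<forall>P\<in>\<P>. \<forall>x. x \<in> P \<and> x \<in> K \<longrightarrow>
          \<kappa> * (infdist x S)\<^sup>2 \<le> real_of_ereal (tilt h \<nu> x) - m" by auto
      \<comment> \<open>The factor 2 offsets the \<open>\<kappa> / 2\<close> in the definition of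
        firm convexity.\<close>
      have "ereal m + ereal (2 * \<kappa> / 2 * (infdist x S)\<^sup>2) \<le> tilt h \<nu> x" if "x \<in> K" for x
      proof (cases "x \<in> dom_of h")
        case True
        then obtain P where P: "P \<in> \<P>" "x \<in> P" using \<P>(2) by blast
        then have "\<kappa> * (infdist x S)\<^sup>2 \<le> q P x" using \<kappa>(2) that tq[OF P] by fastforce
        then show ?thesis using tq[OF P] by simp
      next
        case False
        then have "tilt h \<nu> x = \<infinity>" by (simp add: dom_of_def tilt_def)
        then show ?thesis by simp
      qed
      then show ?thesis using \<kappa>(1) by (intro exI[of _ "2 * \<kappa>"]) auto
    qed
    then show ?thesis unfolding firmly_convex_rel_def using proper closed conv by (simp add: inf_m S_def)
  qed
  then show ?thesis using proper closed conv by (auto simp: firmly_convex_def)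
qed

text \<open>Each \<open>\<beta>\<close> contributes to the epigraph a halfspace if
  \<open>h \<beta>\<close> is finite, the whole space if it is \<open>\<infinity>\<close> and the
  empty set if it is \<open>-\<infinity>\<close>; all are convex.\<close>

lemma convex_fenchel_conjugate: "convex_fun (fenchel_conjugate h)"
proof -
  have "epi (fenchel_conjugate h) = (\<Inter>\<beta>. {w. ereal (fst w \<bullet> \<beta>) - h \<beta> \<le> ereal (snd w)})"
    by (auto simp: epi_def fenchel_conjugate_def SUP_le_iff)
  moreover have "convex {w. ereal (fst w \<bullet> \<beta>) - h \<beta> \<le> ereal (snd w)}" for \<beta>
  proof (cases "h \<beta>")
    case (real r)
    have "{w. ereal (fst w \<bullet> \<beta>) - h \<beta> \<le> ereal (snd w)} = {w. (\<beta>, -1) \<bullet> w \<le> r}"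
      by (auto simp: real inner_prod_def inner_commute algebra_simps)
    then show ?thesis by (simp add: convex_halfspace_le)
  qed auto
  ultimately show ?thesis unfolding convex_fun_def by (simp add: convex_INT)
qed


section \<open>Closure properties of quadratic functions and polyhedra\<close>

text \<open>The formula is required on the whole space, so that sums and multiples can be formed
  without reference to a piece.\<close>

definition quadratic_fun :: "(real^'n \<Rightarrow> real) \<Rightarrow> bool" where
  "quadratic_fun f \<longleftrightarrow> (\<exists>(Q :: real^'n^'n) b c. transpose Q = Q \<and>
     (\<forall>\<beta>. f \<beta> = 1/2 * (\<beta> \<bullet> (Q *v \<beta>)) + b \<bullet> \<beta> + c))"

lemma linear_functional_inner:
  fixes f :: "'a::euclidean_space \<Rightarrow> real"
  assumes "linear f"
  obtains a where "\<And>x. f x = a \<bullet> x"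
  using adjoint_works[OF assms, of _ 1] that[of "adjoint f 1"] by (simp add: inner_commute)

lemma quadratic_fun_linear:
  assumes "linear f"
  shows "quadratic_fun (\<lambda>x. f x + c)"
proof -
  obtain b where "\<And>x. f x = b \<bullet> x" using linear_functional_inner[OF assms] by blast
  then show ?thesis unfolding quadratic_fun_def
    by (intro exI[of _ 0] exI[of _ b] exI[of _ c]) (simp add: transpose_def vec_eq_iff)
qed

lemma quadratic_fun_linear_square:
  assumes "linear f"
  shows "quadratic_fun (\<lambda>x. (f x)\<^sup>2)"
proof -
  obtain a where a: "\<And>x. f x = a \<bullet> x" using linear_functional_inner[OF assms] by blast
  \<comment> \<open>Twice the rank-one matrix of \<open>a\<close>; the 2 cancels the 1/2 before the
    quadratic form.\<close>
  define Q :: "real^'a^'a" where "Q = (\<chi> i j. 2 * (a $ i * a $ j))"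
  have "Q *v x = (2 * (a \<bullet> x)) *\<^sub>R a" for x
    by (simp add: Q_def vec_eq_iff matrix_vector_mult_def inner_vec_def sum_distrib_left sum_distrib_right ac_simps)
  then have "(f x)\<^sup>2 = 1/2 * (x \<bullet> (Q *v x)) + 0 \<bullet> x + 0" for x
    by (simp add: a power2_eq_square inner_commute)
  moreover have "transpose Q = Q" by (simp add: Q_def transpose_def vec_eq_iff mult.commute)
  ultimately show ?thesis unfolding quadratic_fun_def by blast
qed

lemma quadratic_fun_const: "quadratic_fun (\<lambda>x. c)"
  using quadratic_fun_linear[OF linear_zero, of c] by simp

lemma quadratic_fun_add:
  assumes "quadratic_fun f" "quadratic_fun g"
  shows "quadratic_fun (\<lambda>x. f x + g x)"
proof -
  obtain Q b c where "transpose Q = Q" "\<And>x. f x = 1/2 * (x \<bullet> (Q *v x)) + b \<bullet> x + c"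
    using assms(1) unfolding quadratic_fun_def by blast
  moreover obtain Q' b' c' where "transpose Q' = Q'" "\<And>x. g x = 1/2 * (x \<bullet> (Q' *v x)) + b' \<bullet> x + c'"
    using assms(2) unfolding quadratic_fun_def by blast
  ultimately have "transpose (Q + Q') = Q + Q'"
    "\<And>x. f x + g x = 1/2 * (x \<bullet> ((Q + Q') *v x)) + (b + b') \<bullet> x + (c + c')"
    by (simp_all add: transpose_def vec_eq_iff matrix_vector_mult_add_rdistrib inner_simps algebra_simps)
  then show ?thesis unfolding quadratic_fun_def by blast
qed

lemma quadratic_fun_cmult:
  assumes "quadratic_fun f"
  shows "quadratic_fun (\<lambda>x. r * f x)"
proof -
  obtain Q b c where "transpose Q = Q" "\<And>x. f x = 1/2 * (x \<bullet> (Q *v x)) + b \<bullet> x + c"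
    using assms unfolding quadratic_fun_def by blast
  then have "transpose (r *\<^sub>R Q) = r *\<^sub>R Q"
    "\<And>x. r * f x = 1/2 * (x \<bullet> ((r *\<^sub>R Q) *v x)) + (r *\<^sub>R b) \<bullet> x + (r * c)"
    by (simp_all add: transpose_def vec_eq_iff scaleR_matrix_vector_assoc[symmetric] inner_simps algebra_simps)
  then show ?thesis unfolding quadratic_fun_def by blast
qed

lemma quadratic_fun_sum:
  assumes "\<And>i. i \<in> A \<Longrightarrow> quadratic_fun (f i)"
  shows "quadratic_fun (\<lambda>x. \<Sum>i\<in>A. f i x)"
  using assms by (induction A rule: infinite_finite_induct) (auto intro: quadratic_fun_const quadratic_fun_add)

lemma plqI:
  assumes "finite I" and dom: "dom_of h = (\<Union>i\<in>I. P i)" and "\<And>i. i \<in> I \<Longrightarrow> polyhedron (P i)"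
    and "\<And>i. i \<in> I \<Longrightarrow> quadratic_fun (q i)"
    and "\<And>i \<beta>. i \<in> I \<Longrightarrow> \<beta> \<in> P i \<Longrightarrow> h \<beta> = ereal (q i \<beta>)"
  shows "plq h"
  unfolding plq_def
proof (intro exI[of _ "P ` I"] conjI ballI)
  fix p assume "p \<in> P ` I"
  then obtain i where i: "i \<in> I" and p: "p = P i" by blast
  show "polyhedron p" using assms(3)[OF i] p by simp
  obtain Q b c where "transpose Q = Q" "\<And>x. q i x = 1/2 * (x \<bullet> (Q *v x)) + b \<bullet> x + c"
    using assms(4)[OF i] unfolding quadratic_fun_def by blast
  then show "\<exists>Q b c. transpose Q = Q \<and> (\<forall>\<beta>\<in>p. h \<beta> = ereal (1/2 * (\<beta> \<bullet> (Q *v \<beta>)) + b \<bullet> \<beta> + c))"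
    using assms(5)[OF i] p by (intro exI[of _ Q] exI[of _ b] exI[of _ c]) simp
qed (use assms in auto)

lemma polyhedron_linear_le:
  fixes f g :: "'a::euclidean_space \<Rightarrow> real"
  assumes "linear f" "linear g"
  shows "polyhedron {x. f x + c \<le> g x + d}"
proof -
  obtain a b where "\<And>x. f x = a \<bullet> x" "\<And>x. g x = b \<bullet> x"
    using linear_functional_inner assms by metis
  then have "{x. f x + c \<le> g x + d} = {x. (a - b) \<bullet> x \<le> d - c}"
    by (auto simp: inner_diff_left)
  then show ?thesis using polyhedron_halfspace_le by metis
qed

lemma polyhedron_linear_le_const:
  fixes f :: "'a::euclidean_space \<Rightarrow> real"
  assumes "linear f"
  shows "polyhedron {x. f x \<le> c}" "polyhedron {x. c \<le> f x}"
  using polyhedron_linear_le[OF assms linear_zero, of 0 c] polyhedron_linear_le[OF linear_zero assms, of c 0]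
  by simp_all

lemma polyhedron_linear_le_linear:
  fixes f g :: "'a::euclidean_space \<Rightarrow> real"
  assumes "linear f" "linear g"
  shows "polyhedron {x. f x \<le> g x}"
  using polyhedron_linear_le[OF assms, of 0 0] by simp

lemma polyhedron_Collect_conj:
  "polyhedron {x. A x} \<Longrightarrow> polyhedron {x. B x} \<Longrightarrow> polyhedron {x. A x \<and> B x}"
  by (simp add: Collect_conj_eq)

lemma polyhedron_Collect_ball:
  assumes "finite I" "\<And>i. i \<in> I \<Longrightarrow> polyhedron {x. A i x}"
  shows "polyhedron {x. \<forall>i\<in>I. A i x}"
proof -
  have "{x. \<forall>i\<in>I. A i x} = \<Inter> ((\<lambda>i. {x. A i x}) ` I)" by auto
  then show ?thesis using assms by auto
qed

lemma linear_scaled_component: "linear (\<lambda>x::real^'n. c * x $ j)"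
  by (rule linearI) (auto simp: algebra_simps)

lemma linear_sum_scaled_components: "linear (\<lambda>x::real^'n. \<Sum>j\<in>A. c j * x $ j)"
  by (intro linear_compose_sum ballI linear_scaled_component)


section \<open>The node function\<close>

text \<open>These are the tangents of the perspective function \<open>b\<^sup>2 / z\<close>,
  obtained from \<open>(b - a * z)\<^sup>2 \<ge> 0\<close> and exact for \<open>a = b / z\<close>.
  At \<open>z = 0\<close> both sides are 0, since division by zero yields 0.\<close>

lemma sq_div_ge_affine:
  fixes b z :: real
  assumes "0 \<le> z" "z = 0 \<Longrightarrow> b = 0"
  shows "2 * b * a - a\<^sup>2 * z \<le> b\<^sup>2 / z"
proof (cases "z = 0")
  case False
  have "0 \<le> (b - a * z)\<^sup>2 / z" using assms by simp
  also have "\<dots> = b\<^sup>2 / z - (2 * b * a - a\<^sup>2 * z)"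
    using False by (simp add: power2_eq_square field_simps)
  finally show ?thesis by simp
qed (use assms in auto)

text \<open>The tangent with the slope \<open>B / Z\<close> of the combined point is exact there and
  lies below the function at both given points.\<close>

lemma sq_div_convex:
  fixes b b' z z' :: real
  assumes "0 \<le> z" "z = 0 \<Longrightarrow> b = 0" "0 \<le> z'" "z' = 0 \<Longrightarrow> b' = 0" and "0 \<le> u" "0 \<le> v"
  shows "(u * b + v * b')\<^sup>2 / (u * z + v * z') \<le> u * (b\<^sup>2 / z) + v * (b'\<^sup>2 / z')"
proof -
  define B Z a where "B = u * b + v * b'" and "Z = u * z + v * z'" and "a = B / Z"
  have "u * (2 * b * a - a\<^sup>2 * z) + v * (2 * b' * a - a\<^sup>2 * z') \<le> u * (b\<^sup>2 / z) + v * (b'\<^sup>2 / z')"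
    using assms by (intro add_mono mult_left_mono sq_div_ge_affine) auto
  moreover have "u * (2 * b * a - a\<^sup>2 * z) + v * (2 * b' * a - a\<^sup>2 * z') = 2 * B * a - a\<^sup>2 * Z"
    by (simp add: B_def Z_def algebra_simps)
  moreover have "2 * B * a - a\<^sup>2 * Z = B\<^sup>2 / Z"
    by (cases "Z = 0") (auto simp: a_def power2_eq_square)
  ultimately show ?thesis by (simp add: B_def Z_def)
qed

text \<open>A sign pattern is encoded by its set of positive indices. There are finitely many
  patterns, and on the orthant of each one absolute values are linear.\<close>

definition signed :: "'n set \<Rightarrow> 'n \<Rightarrow> real" where
  "signed S j = (if j \<in> S then 1 else -1)"

lemma signed_mult_eq_abs: "0 \<le> signed S j * x \<Longrightarrow> signed S j * x = \<bar>x\<bar>"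
  by (auto simp: signed_def split: if_splits)

lemma signed_nonneg_set: "signed {j. 0 \<le> x $ j} i * x $ i = \<bar>x $ i\<bar>"
  by (simp add: signed_def)

locale node =
  fixes k :: nat and M :: real and J0 J1 Jf :: "'n::finite set"
  assumes M_pos: "M > 0"
    and cover: "J0 \<union> J1 \<union> Jf = UNIV"
    and disjoint: "J0 \<inter> J1 = {}" "J0 \<inter> Jf = {}" "J1 \<inter> Jf = {}"
    and card_J1: "card J1 \<le> k"
begin

abbreviation "g \<equiv> node_fun k M J0 J1 Jf"
abbreviation "feasible \<beta> z \<equiv> (\<beta>, z) \<in> node_feasible k M J0 J1 Jf"

definition free :: nat where "free = k - card J1"

text \<open>A real-valued form of the cost: at feasible points \<open>z $ j = 0\<close> forces
  \<open>\<beta> $ j = 0\<close>, where division by zero agrees with the convention of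
  \<open>sq_over\<close>.\<close>

definition objective :: "real^'n \<Rightarrow> real^'n \<Rightarrow> real" where
  "objective \<beta> z = 1/2 * (\<Sum>j\<in>UNIV. (\<beta> $ j)\<^sup>2 / z $ j)"

lemma real_free: "real free = real k - real (card J1)"
  using card_J1 by (simp add: free_def of_nat_diff)

lemma sum_split: "(\<Sum>j\<in>UNIV. x j) = (\<Sum>j\<in>J0. x j) + (\<Sum>j\<in>J1. x j) + (\<Sum>j\<in>Jf. (x j :: real))"
proof -
  have "(\<Sum>j\<in>UNIV. x j) = (\<Sum>j\<in>J0 \<union> J1. x j) + (\<Sum>j\<in>Jf. x j)"
    unfolding cover[symmetric] using disjoint by (intro sum.union_disjoint) auto
  then show ?thesis using disjoint by (simp add: sum.union_disjoint)
qed

lemma sum_split_free: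
  assumes "A \<subseteq> Jf"
  shows "(\<Sum>j\<in>UNIV. x j) =
    (\<Sum>j\<in>J0. x j) + (\<Sum>j\<in>J1. x j) + (\<Sum>j\<in>A. x j) + (\<Sum>j\<in>Jf - A. (x j :: real))"
  using sum_split[of x] sum.subset_diff[OF assms, of x] by simp

lemma sum_J1_Un:
  assumes "A \<subseteq> Jf"
  shows "(\<Sum>j\<in>J1 \<union> A. x j) = (\<Sum>j\<in>J1. x j) + (\<Sum>j\<in>A. (x j :: real))"
  using assms disjoint by (intro sum.union_disjoint) auto

lemma feasibleD:
  assumes "feasible \<beta> z"
  shows "0 \<le> z $ j" "z $ j \<le> 1" "\<bar>\<beta> $ j\<bar> \<le> M * z $ j" "\<bar>\<beta> $ j\<bar> \<le> M"
    "z $ j = 0 \<Longrightarrow> \<beta> $ j = 0" "j \<in> J0 \<Longrightarrow> z $ j = 0" "j \<in> J1 \<Longrightarrow> z $ j = 1" "j \<in> J0 \<Longrightarrow> \<beta> $ j = 0"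
    "(\<Sum>j\<in>Jf. z $ j) \<le> real free"
proof -
  show b: "\<bar>\<beta> $ j\<bar> \<le> M * z $ j" for j using assms by (simp add: node_feasible_def)
  show 0: "0 \<le> z $ j" for j
    using b[of j] M_pos by (metis abs_ge_zero order_trans zero_le_mult_iff not_less)
  have "j \<in> J0 \<or> j \<in> J1 \<or> j \<in> Jf" using cover by blast
  then show 1: "z $ j \<le> 1" using assms by (auto simp: node_feasible_def)
  show "\<bar>\<beta> $ j\<bar> \<le> M" using b[of j] mult_left_mono[OF 1 less_imp_le[OF M_pos]] by simp
  show e: "\<beta> $ j = 0" if "z $ j = 0" for j using b[of j] that by simp
  show "z $ j = 0" if "j \<in> J0" using assms that by (simp add: node_feasible_def)
  then show "\<beta> $ j = 0" if "j \<in> J0" using e that by simp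
  show z1: "z $ j = 1" if "j \<in> J1" for j using assms that by (simp add: node_feasible_def)
  have "(\<Sum>j\<in>J0. z $ j) = 0" using assms by (simp add: node_feasible_def)
  moreover have "(\<Sum>j\<in>J1. z $ j) = real (card J1)" using z1 by simp
  ultimately show "(\<Sum>j\<in>Jf. z $ j) \<le> real free"
    using assms by (simp add: node_feasible_def sum_split real_free)
qed

lemma node_fun_eq: "g \<beta> = (INF z\<in>{z. feasible \<beta> z}. ereal (objective \<beta> z))"
  unfolding node_fun_def
proof (rule INF_cong[OF refl])
  fix z assume "z \<in> {z. feasible \<beta> z}"
  then have "sq_over (\<beta> $ j) (z $ j) = ereal ((\<beta> $ j)\<^sup>2 / z $ j)" for j
    using feasibleD(5)[of \<beta> z j] by (auto simp: sq_over_def)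
  then show "ereal (1/2) * (\<Sum>j\<in>UNIV. sq_over (\<beta> $ j) (z $ j)) = ereal (objective \<beta> z)"
    by (simp add: objective_def)
qed

lemma node_fun_le: "feasible \<beta> z \<Longrightarrow> g \<beta> \<le> ereal (objective \<beta> z)"
  unfolding node_fun_eq by (rule INF_lower) simp

section \<open>The minimum over z in closed form\<close>

definition rest :: "'n set \<Rightarrow> real^'n \<Rightarrow> real" where
  "rest A \<beta> = (\<Sum>j\<in>Jf - A. \<bar>\<beta> $ j\<bar>)"

definition budget :: "'n set \<Rightarrow> real" where
  "budget A = real free - real (card A)"

text \<open>\<open>A\<close> collects the free indices with optimal \<open>z $ j = 1\<close>; the remaining ones share the budget in
  proportion to \<open>\<bar>\<beta> $ j\<bar>\<close>. With \<open>budget A = 0\<close> the conditions force \<open>rest A \<beta> = 0\<close>, and the quotient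
  below is then \<open>0\<close> as it should be.\<close>

definition node_value :: "'n set \<Rightarrow> real^'n \<Rightarrow> real" where
  "node_value A \<beta> = 1/2 * ((\<Sum>j\<in>J1 \<union> A. (\<beta> $ j)\<^sup>2) + (rest A \<beta>)\<^sup>2 / budget A)"

text \<open>Weak duality. The ratio \<open>s\<close> is the common value of
  \<open>\<bar>\<beta> $ j\<bar> / z $ j\<close> outside \<open>A\<close> at the expected optimum,
  and \<open>s\<^sup>2 / 2\<close> is the price of one unit of budget. Tangents of slope
  \<open>\<beta> $ j\<close> on \<open>A\<close> and \<open>s\<close> outside bound the cost below;
  the budget constraint then removes z.\<close>

lemma node_value_le:
  assumes A: "A \<subseteq> Jf" "card A \<le> free" and dom: "\<And>j. j \<in> A \<Longrightarrow> rest A \<beta> \<le> budget A * \<bar>\<beta> $ j\<bar>"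
    and z: "feasible \<beta> z"
  shows "node_value A \<beta> \<le> objective \<beta> z"
proof -
  define s where "s = rest A \<beta> / budget A"
  have N: "0 \<le> budget A" using A by (simp add: budget_def)
  have R: "0 \<le> rest A \<beta>" by (simp add: rest_def sum_nonneg)
  have s: "0 \<le> s" using N R by (simp add: s_def)
  have J0: "(\<Sum>j\<in>J0. (\<beta> $ j)\<^sup>2 / z $ j) = 0" using feasibleD(8)[OF z] by simp
  have J1: "(\<Sum>j\<in>J1. (\<beta> $ j)\<^sup>2 / z $ j) = (\<Sum>j\<in>J1. (\<beta> $ j)\<^sup>2)" using feasibleD(7)[OF z] by simp
  have "(\<beta> $ j)\<^sup>2 + s\<^sup>2 * (1 - z $ j) \<le> (\<beta> $ j)\<^sup>2 / z $ j" if "j \<in> A" for j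
  proof -
    have "s \<le> \<bar>\<beta> $ j\<bar>"
      using dom[OF that] N by (cases "budget A = 0") (auto simp: s_def divide_le_eq mult.commute)
    then have "s\<^sup>2 \<le> (\<beta> $ j)\<^sup>2" using power_mono[OF _ s, of "\<bar>\<beta> $ j\<bar>" 2] by simp
    then have "s\<^sup>2 * (1 - z $ j) \<le> (\<beta> $ j)\<^sup>2 * (1 - z $ j)"
      using feasibleD(2)[OF z, of j] by (intro mult_right_mono) auto
    moreover have "2 * \<beta> $ j * \<beta> $ j - (\<beta> $ j)\<^sup>2 * z $ j \<le> (\<beta> $ j)\<^sup>2 / z $ j"
      by (rule sq_div_ge_affine[OF feasibleD(1,5)[OF z]])
    ultimately show ?thesis by (simp add: algebra_simps power2_eq_square)
  qed
  then have "(\<Sum>j\<in>A. (\<beta> $ j)\<^sup>2 + s\<^sup>2 * (1 - z $ j)) \<le> (\<Sum>j\<in>A. (\<beta> $ j)\<^sup>2 / z $ j)"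
    by (rule sum_mono)
  then have onA: "(\<Sum>j\<in>A. (\<beta> $ j)\<^sup>2) + s\<^sup>2 * (real (card A) - (\<Sum>j\<in>A. z $ j)) \<le> (\<Sum>j\<in>A. (\<beta> $ j)\<^sup>2 / z $ j)"
    by (simp add: sum.distrib sum_distrib_left[symmetric] sum_subtractf)
  have "2 * \<bar>\<beta> $ j\<bar> * s - s\<^sup>2 * z $ j \<le> (\<beta> $ j)\<^sup>2 / z $ j" for j
    using sq_div_ge_affine[of "z $ j" "\<bar>\<beta> $ j\<bar>" s] feasibleD(1,5)[OF z, of j] by simp
  then have "(\<Sum>j\<in>Jf - A. 2 * \<bar>\<beta> $ j\<bar> * s - s\<^sup>2 * z $ j) \<le> (\<Sum>j\<in>Jf - A. (\<beta> $ j)\<^sup>2 / z $ j)"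
    by (rule sum_mono)
  then have offA: "2 * rest A \<beta> * s - s\<^sup>2 * (\<Sum>j\<in>Jf - A. z $ j) \<le> (\<Sum>j\<in>Jf - A. (\<beta> $ j)\<^sup>2 / z $ j)"
    by (simp add: rest_def sum_subtractf sum_distrib_left sum_distrib_right)
  have "(\<Sum>j\<in>Jf - A. z $ j) + (\<Sum>j\<in>A. z $ j) \<le> real free"
    using feasibleD(9)[OF z] sum.subset_diff[OF A(1), of "\<lambda>j. z $ j"] by simp
  then have "s\<^sup>2 * ((\<Sum>j\<in>Jf - A. z $ j) + (\<Sum>j\<in>A. z $ j) - real (card A)) \<le> s\<^sup>2 * budget A"
    by (intro mult_left_mono) (auto simp: budget_def)
  moreover have "2 * rest A \<beta> * s - s\<^sup>2 * budget A = (rest A \<beta>)\<^sup>2 / budget A"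
    by (cases "budget A = 0") (auto simp: s_def power2_eq_square)
  ultimately have "(\<Sum>j\<in>A. (\<beta> $ j)\<^sup>2) + (rest A \<beta>)\<^sup>2 / budget A
      \<le> (\<Sum>j\<in>A. (\<beta> $ j)\<^sup>2 / z $ j) + (\<Sum>j\<in>Jf - A. (\<beta> $ j)\<^sup>2 / z $ j)"
    using onA offA by (simp add: algebra_simps)
  then show ?thesis
    unfolding node_value_def objective_def sum_split_free[OF A(1)] J0 J1 sum_J1_Un[OF A(1)]
    by (intro mult_left_mono) simp_all
qed

text \<open>The second condition on \<open>A\<close> keeps the proportional shares at most 1; the
  first one, or the bound on the sum if \<open>A\<close> is empty, makes them large enough for
  \<open>\<bar>\<beta> $ j\<bar> \<le> M * z $ j\<close>.\<close>

lemma node_value_attained: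
  assumes A: "A \<subseteq> Jf" "card A \<le> free"
    and dom: "\<And>j. j \<in> A \<Longrightarrow> rest A \<beta> \<le> budget A * \<bar>\<beta> $ j\<bar>"
      "\<And>j. j \<in> Jf - A \<Longrightarrow> budget A * \<bar>\<beta> $ j\<bar> \<le> rest A \<beta>"
    and \<beta>: "\<And>j. j \<in> J0 \<Longrightarrow> \<beta> $ j = 0" "\<And>j. \<bar>\<beta> $ j\<bar> \<le> M" "(\<Sum>j\<in>Jf. \<bar>\<beta> $ j\<bar>) \<le> M * real free"
  obtains z where "feasible \<beta> z" "objective \<beta> z = node_value A \<beta>"
proof -
  have N: "0 \<le> budget A" using A by (simp add: budget_def)
  have R: "0 \<le> rest A \<beta>" by (simp add: rest_def sum_nonneg)
  \<comment> \<open>This says that the common ratio is at most \<open>M\<close>: it is at most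
    \<open>\<bar>\<beta> $ j\<bar>\<close> for any \<open>j\<close> in \<open>A\<close>.\<close>
  have RN: "rest A \<beta> \<le> M * budget A"
  proof (cases "A = {}")
    case True
    then show ?thesis using \<beta>(3) by (simp add: rest_def budget_def)
  next
    case False
    then obtain j where "j \<in> A" by blast
    then show ?thesis using dom(1)[of j] mult_left_mono[OF \<beta>(2) N, of j] by (simp add: mult.commute)
  qed
  have rest0: "\<beta> $ j = 0" if "rest A \<beta> = 0" "j \<in> Jf - A" for j
    using that sum_nonneg_eq_0_iff[of "Jf - A" "\<lambda>j. \<bar>\<beta> $ j\<bar>"] by (auto simp: rest_def)
  define z :: "real^'n" where
    "z = (\<chi> j. if j \<in> J0 then 0 else if j \<in> J1 \<union> A then 1 else \<bar>\<beta> $ j\<bar> * budget A / rest A \<beta>)"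
  have z0: "z $ j = 0" if "j \<in> J0" for j using that by (simp add: z_def)
  have z1: "z $ j = 1" if "j \<in> J1 \<union> A" for j using that disjoint A(1) by (auto simp: z_def)
  have zr: "z $ j = \<bar>\<beta> $ j\<bar> * budget A / rest A \<beta>" if "j \<in> Jf - A" for j
    using that disjoint by (auto simp: z_def)
  have cases: "j \<in> J0 \<or> j \<in> J1 \<union> A \<or> j \<in> Jf - A" for j using cover by blast
  have zr_range: "0 \<le> z $ j" "z $ j \<le> 1" if "j \<in> Jf - A" for j
    using zr[OF that] dom(2)[OF that] R N by (auto simp: divide_le_eq_1 mult.commute)
  have "feasible \<beta> z"
    unfolding node_feasible_def mem_Collect_eq prod.case
  proof (intro conjI allI ballI)
    have "(\<Sum>j\<in>Jf - A. z $ j) = (\<Sum>j\<in>Jf - A. \<bar>\<beta> $ j\<bar>) * (budget A / rest A \<beta>)"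
      using zr by (simp add: sum_distrib_right sum_divide_distrib)
    \<comment> \<open>Equality holds unless \<open>rest A \<beta> = 0\<close>, in which case the
      left side is 0.\<close>
    also have "\<dots> \<le> budget A" using N by (simp add: rest_def[symmetric])
    finally show "(\<Sum>j\<in>UNIV. z $ j) \<le> real k"
      using z0 z1 by (simp add: sum_split_free[OF A(1)] budget_def real_free)
    show "\<bar>\<beta> $ j\<bar> \<le> M * z $ j" for j
    proof -
      consider "j \<in> J0" | "j \<in> J1 \<union> A" | "j \<in> Jf - A" using cases by blast
      then show ?thesis
      proof cases
        case 3
        show ?thesis
        proof (cases "rest A \<beta> = 0")
          case True
          then show ?thesis using rest0 3 zr by simp
        next
          case False
          then have "\<bar>\<beta> $ j\<bar> * rest A \<beta> \<le> \<bar>\<beta> $ j\<bar> * (M * budget A)"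
            using RN by (intro mult_left_mono) auto
          then have "\<bar>\<beta> $ j\<bar> \<le> \<bar>\<beta> $ j\<bar> * (M * budget A) / rest A \<beta>"
            using False R by (simp add: pos_le_divide_eq)
          then show ?thesis by (simp add: zr[OF 3] ac_simps)
        qed
      qed (use \<beta> z0 z1 in auto)
    qed
    show "z $ j \<in> {0..1}" if "j \<in> Jf" for j
      using zr_range[of j] z1[of j] that by (cases "j \<in> A") auto
  qed (use z0 z1 in auto)
  moreover have "objective \<beta> z = node_value A \<beta>"
  proof -
    have "(\<beta> $ j)\<^sup>2 / z $ j = \<bar>\<beta> $ j\<bar> * (rest A \<beta> / budget A)" if "j \<in> Jf - A" for j
    proof (cases "\<beta> $ j = 0")
      case False
      then show ?thesis unfolding zr[OF that]
        by (cases "budget A = 0") (auto simp: power2_eq_square abs_if)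
    qed simp
    then have "(\<Sum>j\<in>Jf - A. (\<beta> $ j)\<^sup>2 / z $ j) = rest A \<beta> * (rest A \<beta> / budget A)"
      by (simp add: rest_def sum_distrib_right sum_divide_distrib)
    then show ?thesis using \<beta>(1) z1
      by (simp add: node_value_def objective_def sum_split_free[OF A(1)] sum_J1_Un[OF A(1)] power2_eq_square)
  qed
  ultimately show thesis using that by blast
qed

lemma node_fun_eq_value:
  assumes "A \<subseteq> Jf" "card A \<le> free"
    and "\<And>j. j \<in> A \<Longrightarrow> rest A \<beta> \<le> budget A * \<bar>\<beta> $ j\<bar>"
      "\<And>j. j \<in> Jf - A \<Longrightarrow> budget A * \<bar>\<beta> $ j\<bar> \<le> rest A \<beta>"
    and "\<And>j. j \<in> J0 \<Longrightarrow> \<beta> $ j = 0" "\<And>j. \<bar>\<beta> $ j\<bar> \<le> M" "(\<Sum>j\<in>Jf. \<bar>\<beta> $ j\<bar>) \<le> M * real free"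
  shows "g \<beta> = ereal (node_value A \<beta>)" "\<exists>z. feasible \<beta> z \<and> g \<beta> = ereal (objective \<beta> z)"
proof -
  obtain z where z: "feasible \<beta> z" "objective \<beta> z = node_value A \<beta>"
    using node_value_attained[OF assms] by blast
  have "ereal (node_value A \<beta>) \<le> g \<beta>" unfolding node_fun_eq
    using node_value_le[OF assms(1-3)] by (intro INF_greatest) auto
  then show eq: "g \<beta> = ereal (node_value A \<beta>)" using node_fun_le[OF z(1)] z(2) by auto
  then show "\<exists>z. feasible \<beta> z \<and> g \<beta> = ereal (objective \<beta> z)" using z by auto
qed

text \<open>A maximal set satisfying the first condition satisfies the second: an index that violates it
  could be added.\<close>

lemma saturated_set_exists:
  obtains A where "A \<subseteq> Jf" "card A \<le> free"
    "\<And>j. j \<in> A \<Longrightarrow> rest A \<beta> \<le> budget A * \<bar>\<beta> $ j\<bar>"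
    "\<And>j. j \<in> Jf - A \<Longrightarrow> budget A * \<bar>\<beta> $ j\<bar> \<le> rest A \<beta>"
proof -
  define \<A> where "\<A> = {A. A \<subseteq> Jf \<and> card A \<le> free \<and> (\<forall>j\<in>A. rest A \<beta> \<le> budget A * \<bar>\<beta> $ j\<bar>)}"
  have "finite \<A>" by (rule finite)
  moreover have "{} \<in> \<A>" by (simp add: \<A>_def)
  ultimately obtain A where A: "A \<in> \<A>" and max: "\<And>B. B \<in> \<A> \<Longrightarrow> A \<subseteq> B \<Longrightarrow> A = B"
    using finite_has_maximal[of \<A>] by blast
  have "budget A * \<bar>\<beta> $ i\<bar> \<le> rest A \<beta>" if i: "i \<in> Jf - A" for i
  proof (rule ccontr)
    assume "\<not> ?thesis"
    then have less: "rest A \<beta> < budget A * \<bar>\<beta> $ i\<bar>" by simp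
    moreover have "0 \<le> rest A \<beta>" by (simp add: rest_def sum_nonneg)
    ultimately have "0 < budget A" by (metis abs_ge_zero less_le_trans not_less mult_nonpos_nonneg)
    then have card: "card (insert i A) \<le> free" using i by (simp add: budget_def)
    have rest': "rest (insert i A) \<beta> = rest A \<beta> - \<bar>\<beta> $ i\<bar>"
    proof -
      have "Jf - insert i A = Jf - A - {i}" by blast
      then show ?thesis using i by (simp add: rest_def sum_diff1)
    qed
    have budget': "budget (insert i A) = budget A - 1" using i by (simp add: budget_def)
    have "0 \<le> budget A - 1" using card i by (simp add: budget_def)
    \<comment> \<open>Adding \<open>i\<close> lowers \<open>rest\<close> by
      \<open>\<bar>\<beta> $ i\<bar>\<close> and the budget by 1. For
      \<open>\<bar>\<beta> $ j\<bar>\<close> at least as large, the violated inequality at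
      \<open>i\<close> gives the claim; for a smaller one, the old inequality at \<open>j\<close>
      loses more on the left than on the right.\<close>
    have "rest (insert i A) \<beta> \<le> budget (insert i A) * \<bar>\<beta> $ j\<bar>" if "j \<in> insert i A" for j
    proof (cases "\<bar>\<beta> $ i\<bar> \<le> \<bar>\<beta> $ j\<bar>")
      case True
      have "rest A \<beta> - \<bar>\<beta> $ i\<bar> \<le> (budget A - 1) * \<bar>\<beta> $ i\<bar>" using less by (simp add: algebra_simps)
      also have "\<dots> \<le> (budget A - 1) * \<bar>\<beta> $ j\<bar>" using True \<open>0 \<le> budget A - 1\<close> by (rule mult_left_mono)
      finally show ?thesis by (simp add: rest' budget')
    next
      case False
      then have "j \<in> A" using that by auto
      then have "rest A \<beta> \<le> budget A * \<bar>\<beta> $ j\<bar>" using A by (simp add: \<A>_def)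
      then show ?thesis using False by (simp add: rest' budget' algebra_simps)
    qed
    then have "insert i A \<in> \<A>" using A i card by (simp add: \<A>_def)
    then show False using max[of "insert i A"] i by blast
  qed
  with A show thesis by (intro that[of A]) (auto simp: \<A>_def)
qed

section \<open>The domain and the polyhedral pieces of \<open>g\<close>\<close>

lemma dom_of_node_fun_feasible:
  assumes "\<beta> \<in> dom_of g"
  obtains z where "feasible \<beta> z"
proof -
  have "\<exists>z. feasible \<beta> z"
  proof (rule ccontr)
    assume "\<not> ?thesis"
    then have "g \<beta> = \<infinity>" by (simp add: node_fun_eq top_ereal_def)
    then show False using assms by (simp add: dom_of_def)
  qed
  then show thesis using that by blast
qed

text \<open>Together these conditions describe the domain without z: a saturated set and
  \<open>node_value_attained\<close> turn them back into a feasible point.\<close>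

lemma feasible_bounds:
  assumes "feasible \<beta> z"
  shows "\<And>j. j \<in> J0 \<Longrightarrow> \<beta> $ j = 0" "\<And>j. \<bar>\<beta> $ j\<bar> \<le> M" "(\<Sum>j\<in>Jf. \<bar>\<beta> $ j\<bar>) \<le> M * real free"
proof -
  have "(\<Sum>j\<in>Jf. \<bar>\<beta> $ j\<bar>) \<le> (\<Sum>j\<in>Jf. M * z $ j)" by (intro sum_mono feasibleD(3)[OF assms])
  also have "\<dots> \<le> M * real free"
    using feasibleD(9)[OF assms] M_pos by (simp add: sum_distrib_left[symmetric])
  finally show "(\<Sum>j\<in>Jf. \<bar>\<beta> $ j\<bar>) \<le> M * real free" .
qed (use feasibleD[OF assms] in auto)

text \<open>Attainment gives each point of the epigraph an exact z instead of nearly optimal ones,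
  both for convexity and for the conjugate.\<close>

lemma node_fun_attained:
  assumes "feasible \<beta> z"
  obtains z' where "feasible \<beta> z'" "g \<beta> = ereal (objective \<beta> z')"
proof -
  obtain A where A: "A \<subseteq> Jf" "card A \<le> free"
    "\<And>j. j \<in> A \<Longrightarrow> rest A \<beta> \<le> budget A * \<bar>\<beta> $ j\<bar>"
    "\<And>j. j \<in> Jf - A \<Longrightarrow> budget A * \<bar>\<beta> $ j\<bar> \<le> rest A \<beta>"
    using saturated_set_exists[of \<beta>] by blast
  show thesis using node_fun_eq_value(2)[OF A feasible_bounds[OF assms]] that by blast
qed

text \<open>\<open>S\<close> fixes the signs and \<open>A\<close> is a saturated set. For
  \<open>J0\<close> the two opposite inequalities force \<open>\<beta> $ j = 0\<close>. Every
  condition is a weak inequality between multiples of components or sums of them, as the polyhedron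
  rules expect.\<close>

definition node_piece :: "'n set \<times> 'n set \<Rightarrow> (real^'n) set" where
  "node_piece = (\<lambda>(S, A). {\<beta>. (\<forall>j\<in>J0. signed S j * \<beta> $ j \<le> 0) \<and>
     (\<forall>j\<in>UNIV. 0 \<le> signed S j * \<beta> $ j \<and> signed S j * \<beta> $ j \<le> M) \<and>
     (\<Sum>j\<in>Jf. signed S j * \<beta> $ j) \<le> M * real free \<and>
     (\<forall>j\<in>A. (\<Sum>i\<in>Jf - A. signed S i * \<beta> $ i) \<le> (budget A * signed S j) * \<beta> $ j) \<and>
     (\<forall>j\<in>Jf - A. (budget A * signed S j) * \<beta> $ j \<le> (\<Sum>i\<in>Jf - A. signed S i * \<beta> $ i))})"

text \<open>The factor 1 and the coefficient \<open>1 / budget A\<close> put each term into the form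
  of the closure rules for \<open>quadratic_fun\<close>.\<close>

definition node_quadratic :: "'n set \<times> 'n set \<Rightarrow> real^'n \<Rightarrow> real" where
  "node_quadratic = (\<lambda>(S, A) \<beta>. 1/2 * ((\<Sum>j\<in>J1 \<union> A. (1 * \<beta> $ j)\<^sup>2)
     + 1 / budget A * (\<Sum>j\<in>Jf - A. signed S j * \<beta> $ j)\<^sup>2))"

lemma polyhedron_node_piece: "polyhedron (node_piece SA)"
  unfolding node_piece_def case_prod_beta
  by (intro polyhedron_Collect_conj polyhedron_Collect_ball polyhedron_linear_le_const
      polyhedron_linear_le_linear linear_scaled_component linear_sum_scaled_components finite)

lemma quadratic_fun_node_quadratic: "quadratic_fun (node_quadratic SA)"
  unfolding node_quadratic_def case_prod_beta
  by (intro quadratic_fun_cmult quadratic_fun_add quadratic_fun_sum quadratic_fun_linear_square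
      linear_scaled_component linear_sum_scaled_components)

lemma node_piece_value:
  assumes A: "A \<subseteq> Jf" "card A \<le> free" and \<beta>: "\<beta> \<in> node_piece (S, A)"
  shows "g \<beta> = ereal (node_quadratic (S, A) \<beta>)"
proof -
  have abs: "signed S j * \<beta> $ j = \<bar>\<beta> $ j\<bar>" for j
    using \<beta> by (intro signed_mult_eq_abs) (simp add: node_piece_def)
  have rest: "(\<Sum>j\<in>Jf - A. signed S j * \<beta> $ j) = rest A \<beta>" by (simp add: abs rest_def)
  have "g \<beta> = ereal (node_value A \<beta>)"
    by (rule node_fun_eq_value(1)[OF A])
      (use \<beta> in \<open>auto simp: node_piece_def abs rest_def mult.assoc\<close>)
  also have "node_value A \<beta> = node_quadratic (S, A) \<beta>"
    by (simp add: node_value_def node_quadratic_def rest)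
  finally show ?thesis .
qed

lemma plq_node_fun: "plq g"
proof (rule plqI)
  define I where "I = (UNIV :: 'n set set) \<times> {A. A \<subseteq> Jf \<and> card A \<le> free}"
  show "finite I" by (rule finite)
  show "polyhedron (node_piece i)" "quadratic_fun (node_quadratic i)" for i
    by (rule polyhedron_node_piece quadratic_fun_node_quadratic)+
  show val: "g \<beta> = ereal (node_quadratic i \<beta>)" if "i \<in> I" "\<beta> \<in> node_piece i" for i \<beta>
    using that node_piece_value by (cases i) (auto simp: I_def)
  show "dom_of g = (\<Union>i\<in>I. node_piece i)"
  proof (intro equalityI subsetI)
    fix \<beta> assume "\<beta> \<in> dom_of g"
    then obtain z where z: "feasible \<beta> z" by (rule dom_of_node_fun_feasible)
    obtain A where A: "A \<subseteq> Jf" "card A \<le> free"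
      "\<And>j. j \<in> A \<Longrightarrow> rest A \<beta> \<le> budget A * \<bar>\<beta> $ j\<bar>"
      "\<And>j. j \<in> Jf - A \<Longrightarrow> budget A * \<bar>\<beta> $ j\<bar> \<le> rest A \<beta>"
      using saturated_set_exists[of \<beta>] by blast
    have "\<beta> \<in> node_piece ({j. 0 \<le> \<beta> $ j}, A)"
      using A feasible_bounds[OF z]
      by (simp add: node_piece_def signed_nonneg_set mult.assoc rest_def)
    then show "\<beta> \<in> (\<Union>i\<in>I. node_piece i)" using A by (auto simp: I_def)
  next
    fix \<beta> assume "\<beta> \<in> (\<Union>i\<in>I. node_piece i)"
    then show "\<beta> \<in> dom_of g" using val by (auto simp: dom_of_def)
  qed
qed

section \<open>Properness and convexity of \<open>g\<close>\<close>

lemma objective_nonneg: "feasible \<beta> z \<Longrightarrow> 0 \<le> objective \<beta> z"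
  unfolding objective_def using feasibleD(1)[of \<beta> z] by (simp add: sum_nonneg)

lemma proper_node_fun: "proper_fun g"
  unfolding proper_fun_def
proof
  have "0 \<le> g \<beta>" for \<beta>
    unfolding node_fun_eq using objective_nonneg by (intro INF_greatest) simp
  then show "\<forall>\<beta>. g \<beta> \<noteq> -\<infinity>" by (metis ereal_infty_less_eq(2) zero_ereal_def MInfty_neq_ereal(1))
  have "feasible 0 (\<chi> j. if j \<in> J1 then 1 else 0)"
    using disjoint M_pos card_J1 by (auto simp: node_feasible_def sum.If_cases)
  then have "g 0 \<le> ereal (objective 0 (\<chi> j. if j \<in> J1 then 1 else 0))" by (rule node_fun_le)
  then have "g 0 \<noteq> \<infinity>" by auto
  then show "\<exists>\<beta>. g \<beta> \<noteq> \<infinity>" ..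
qed

text \<open>Partial minimization preserves convexity: optimal z for two points combine to a feasible
  z, and the cost is jointly convex by \<open>sq_div_convex\<close>.\<close>

lemma convex_node_fun: "convex_fun g"
  unfolding convex_fun_def
proof (rule convexI)
  fix x y :: "(real^'n) \<times> real" and u v :: real
  assume xy: "x \<in> epi g" "y \<in> epi g" and uv: "0 \<le> u" "0 \<le> v" "u + v = 1"
  have "\<exists>z. feasible (fst x) z \<and> objective (fst x) z \<le> snd x" if "x \<in> epi g" for x
  proof -
    have le: "g (fst x) \<le> ereal (snd x)" using that by (auto simp: epi_def)
    then have "g (fst x) < \<infinity>" by (rule le_less_trans) simp
    then obtain w where "feasible (fst x) w" using dom_of_node_fun_feasible[of "fst x"] by (auto simp: dom_of_def)
    then obtain z where "feasible (fst x) z" "g (fst x) = ereal (objective (fst x) z)"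
      by (rule node_fun_attained)
    then show ?thesis using le by auto
  qed
  then obtain z w where z: "feasible (fst x) z" "objective (fst x) z \<le> snd x"
    and w: "feasible (fst y) w" "objective (fst y) w \<le> snd y"
    using xy by metis
  let ?\<beta> = "u *\<^sub>R fst x + v *\<^sub>R fst y" and ?z = "u *\<^sub>R z + v *\<^sub>R w"
  have feas: "feasible ?\<beta> ?z"
    unfolding node_feasible_def mem_Collect_eq prod.case
  proof (intro conjI allI ballI)
    have "u * (\<Sum>j\<in>UNIV. z $ j) + v * (\<Sum>j\<in>UNIV. w $ j) \<le> u * real k + v * real k"
      using z(1) w(1) uv by (intro add_mono mult_left_mono) (auto simp: node_feasible_def)
    also have "\<dots> = real k" using uv by (simp flip: distrib_right)
    finally show "(\<Sum>j\<in>UNIV. ?z $ j) \<le> real k" by (simp add: sum.distrib sum_distrib_left)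
    fix j
    have "\<bar>?\<beta> $ j\<bar> \<le> u * \<bar>fst x $ j\<bar> + v * \<bar>fst y $ j\<bar>"
      using uv abs_triangle_ineq[of "u * fst x $ j" "v * fst y $ j"] by (simp add: abs_mult)
    also have "\<dots> \<le> u * (M * z $ j) + v * (M * w $ j)"
      using uv feasibleD(3)[OF z(1)] feasibleD(3)[OF w(1)] by (intro add_mono mult_left_mono) auto
    finally show "\<bar>?\<beta> $ j\<bar> \<le> M * ?z $ j" by (simp add: algebra_simps)
    show "?z $ j = 0" if "j \<in> J0" using that feasibleD(6)[OF z(1)] feasibleD(6)[OF w(1)] by simp
    show "?z $ j = 1" if "j \<in> J1" using that uv feasibleD(7)[OF z(1)] feasibleD(7)[OF w(1)] by simp
    have "u * z $ j + v * w $ j \<le> u * 1 + v * 1"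
      using uv feasibleD(2)[OF z(1)] feasibleD(2)[OF w(1)] by (intro add_mono mult_left_mono) auto
    then show "?z $ j \<in> {0..1}" using uv feasibleD(1)[OF z(1)] feasibleD(1)[OF w(1)] by simp
  qed
  have "objective ?\<beta> ?z \<le> u * objective (fst x) z + v * objective (fst y) w"
  proof -
    have "(?\<beta> $ j)\<^sup>2 / ?z $ j \<le> u * ((fst x $ j)\<^sup>2 / z $ j) + v * ((fst y $ j)\<^sup>2 / w $ j)" for j
      using sq_div_convex[OF feasibleD(1,5)[OF z(1), of j] feasibleD(1,5)[OF w(1), of j] uv(1,2)] by simp
    then have "(\<Sum>j\<in>UNIV. (?\<beta> $ j)\<^sup>2 / ?z $ j) \<le>
        (\<Sum>j\<in>UNIV. u * ((fst x $ j)\<^sup>2 / z $ j) + v * ((fst y $ j)\<^sup>2 / w $ j))"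
      by (rule sum_mono)
    also have "\<dots> = u * (\<Sum>j\<in>UNIV. (fst x $ j)\<^sup>2 / z $ j) + v * (\<Sum>j\<in>UNIV. (fst y $ j)\<^sup>2 / w $ j)"
      by (simp only: sum.distrib sum_distrib_left)
    finally show ?thesis by (simp add: objective_def)
  qed
  also have "\<dots> \<le> u * snd x + v * snd y" using z w uv by (intro add_mono mult_left_mono) auto
  finally have "g ?\<beta> \<le> ereal (u * snd x + v * snd y)"
    using node_fun_le[OF feas] by (meson order_trans ereal_less_eq(3))
  then show "u *\<^sub>R x + v *\<^sub>R y \<in> epi g" by (cases x, cases y) (simp add: epi_def)
qed

end


section \<open>The conjugate of the node function\<close>

definition clip :: "real \<Rightarrow> real \<Rightarrow> real" where
  "clip M a = max (- M) (min a M)"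

text \<open>The supremum of \<open>a * t - t\<^sup>2 / 2\<close> over
  \<open>\<bar>t\<bar> \<le> M\<close>, written through its maximizer
  \<open>t = clip M a\<close>.\<close>

definition huber :: "real \<Rightarrow> real \<Rightarrow> real" where
  "huber M a = a * clip M a - (clip M a)\<^sup>2 / 2"

lemma abs_clip_le: "0 \<le> M \<Longrightarrow> \<bar>clip M a\<bar> \<le> M"
  by (auto simp: clip_def)

lemma huber_inner: "\<bar>a\<bar> \<le> M \<Longrightarrow> huber M a = a\<^sup>2 / 2"
  by (auto simp: huber_def clip_def power2_eq_square max_def min_def abs_le_iff)

lemma huber_outer: "0 < M \<Longrightarrow> M \<le> \<bar>a\<bar> \<Longrightarrow> huber M a = M * \<bar>a\<bar> - M\<^sup>2 / 2"
proof (cases "0 \<le> a")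
  case False
  assume "0 < M" "M \<le> \<bar>a\<bar>"
  with False have "clip M a = - M" by (simp add: clip_def)
  then show ?thesis using False by (simp add: huber_def)
qed (simp add: huber_def clip_def)

lemma huber_nonneg:
  assumes "0 < M"
  shows "0 \<le> huber M a"
proof (cases "\<bar>a\<bar> \<le> M")
  case False
  then have "M * M \<le> M * \<bar>a\<bar>" using assms by (intro mult_left_mono) auto
  then show ?thesis using False assms by (simp add: huber_outer power2_eq_square)
qed (simp add: huber_inner)

lemma fenchel_young_huber:
  assumes "0 < M" "\<bar>t\<bar> \<le> M"
  shows "a * t - t\<^sup>2 / 2 \<le> huber M a"
proof (cases "\<bar>a\<bar> \<le> M")
  case True
  have "0 \<le> (a - t)\<^sup>2" by simp
  then show ?thesis using True by (simp add: huber_inner power2_diff)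
next
  case False
  have "a * t \<le> \<bar>a\<bar> * \<bar>t\<bar>" by (metis abs_ge_self abs_mult)
  \<comment> \<open>The product is twice the gap after \<open>a * t\<close> is replaced by its bound
    \<open>\<bar>a\<bar> * \<bar>t\<bar>\<close>; as a quadratic in \<open>\<bar>t\<bar>\<close> it
    has the root \<open>M\<close>.\<close>
  moreover have "0 \<le> (M - \<bar>t\<bar>) * ((\<bar>a\<bar> - M) + (\<bar>a\<bar> - \<bar>t\<bar>))"
    using False assms by (intro mult_nonneg_nonneg) auto
  moreover have "(M - \<bar>t\<bar>) * ((\<bar>a\<bar> - M) + (\<bar>a\<bar> - \<bar>t\<bar>)) = 2 * (M * \<bar>a\<bar>) - M\<^sup>2 - 2 * (\<bar>a\<bar> * \<bar>t\<bar>) + t\<^sup>2"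
    by (simp add: power2_eq_square algebra_simps)
  moreover have "huber M a = M * \<bar>a\<bar> - M\<^sup>2 / 2" using False assms by (simp add: huber_outer)
  ultimately show ?thesis by linarith
qed

text \<open>The maximizer for \<open>a\<close>, given the sign of \<open>b\<close>, is a competitor
  for \<open>b\<close> with at least the same value.\<close>

lemma huber_mono:
  assumes "0 < M" "\<bar>a\<bar> \<le> \<bar>b\<bar>"
  shows "huber M a \<le> huber M b"
proof -
  define t where "t = (if 0 \<le> b then \<bar>clip M a\<bar> else - \<bar>clip M a\<bar>)"
  have "a * clip M a \<le> \<bar>a\<bar> * \<bar>clip M a\<bar>" by (metis abs_ge_self abs_mult)
  also have "\<dots> \<le> \<bar>b\<bar> * \<bar>clip M a\<bar>" using assms by (intro mult_right_mono) auto
  also have "\<dots> = b * t" by (auto simp: t_def)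
  finally have "a * clip M a \<le> b * t" .
  moreover have "t\<^sup>2 = (clip M a)\<^sup>2" by (simp add: t_def)
  ultimately have "huber M a \<le> b * t - t\<^sup>2 / 2" by (simp add: huber_def)
  also have "\<dots> \<le> huber M b"
    using assms abs_clip_le[of M a] by (intro fenchel_young_huber) (auto simp: t_def)
  finally show ?thesis .
qed

text \<open>The scalar inequality at \<open>t = b / z\<close>, multiplied by \<open>z\<close>. The
  bound is linear in \<open>z\<close>, which reduces the conjugate to a knapsack problem.\<close>

lemma fenchel_young_perspective:
  assumes "0 < M" "0 \<le> z" "\<bar>b\<bar> \<le> M * z"
  shows "a * b - 1/2 * (b\<^sup>2 / z) \<le> z * huber M a"
proof (cases "z = 0")
  case False
  have "z * (a * (b / z) - (b / z)\<^sup>2 / 2) \<le> z * huber M a"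
    using assms False by (intro mult_left_mono fenchel_young_huber) (auto simp: divide_le_eq mult.commute)
  moreover have "z * (a * (b / z) - (b / z)\<^sup>2 / 2) = a * b - 1/2 * (b\<^sup>2 / z)"
    using False by (simp add: field_simps power2_eq_square)
  ultimately show ?thesis by simp
qed (use assms in auto)

context node
begin

text \<open>The disjunction fixes the size of \<open>B\<close> as the minimum of \<open>free\<close>
  and \<open>card Jf\<close>; ties may be broken in any way.\<close>

definition top_set :: "real^'n \<Rightarrow> 'n set \<Rightarrow> bool" where
  "top_set \<alpha> B \<longleftrightarrow> B \<subseteq> Jf \<and> card B \<le> free \<and> (card B = free \<or> B = Jf) \<and>
     (\<forall>i\<in>Jf - B. \<forall>j\<in>B. \<bar>\<alpha> $ i\<bar> \<le> \<bar>\<alpha> $ j\<bar>)"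

text \<open>Greedy choice: the induction runs over an arbitrary target size \<open>m\<close> and
  adds a largest remaining index.\<close>

lemma top_set_exists: "\<exists>B. top_set \<alpha> B"
proof -
  have "\<exists>B\<subseteq>Jf. card B \<le> m \<and> (card B = m \<or> B = Jf) \<and> (\<forall>i\<in>Jf - B. \<forall>j\<in>B. \<bar>\<alpha> $ i\<bar> \<le> \<bar>\<alpha> $ j\<bar>)" for m
  proof (induction m)
    case 0
    show ?case by (intro exI[of _ "{}"]) auto
  next
    case (Suc m)
    then obtain B where B: "B \<subseteq> Jf" "card B \<le> m" "card B = m \<or> B = Jf"
      "\<And>i j. i \<in> Jf - B \<Longrightarrow> j \<in> B \<Longrightarrow> \<bar>\<alpha> $ i\<bar> \<le> \<bar>\<alpha> $ j\<bar>" by blast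
    show ?case
    proof (cases "B = Jf")
      case True
      then show ?thesis using B by (intro exI[of _ B]) auto
    next
      case False
      then have ne: "Jf - B \<noteq> {}" using B(1) by blast
      obtain l where l: "l \<in> Jf - B" and "\<bar>\<alpha> $ l\<bar> = Max ((\<lambda>j. \<bar>\<alpha> $ j\<bar>) ` (Jf - B))"
        by (rule obtains_MAX[OF _ ne, of "\<lambda>j. \<bar>\<alpha> $ j\<bar>"]) auto
      then have le_l: "\<bar>\<alpha> $ i\<bar> \<le> \<bar>\<alpha> $ l\<bar>" if "i \<in> Jf - B" for i using that by simp
      show ?thesis using B l le_l \<open>B \<noteq> Jf\<close> by (intro exI[of _ "insert l B"]) auto
    qed
  qed
  then show ?thesis unfolding top_set_def by blast
qed

text \<open>Fractional knapsack: the largest Huber value outside \<open>B\<close> separates the two sides.\<close>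

lemma knapsack_le_top_set:
  assumes B: "top_set \<alpha> B" and z: "feasible \<beta> z"
  shows "(\<Sum>j\<in>UNIV. z $ j * huber M (\<alpha> $ j)) \<le> (\<Sum>j\<in>J1 \<union> B. huber M (\<alpha> $ j))"
proof -
  let ?h = "\<lambda>j. huber M (\<alpha> $ j)"
  have BJ: "B \<subseteq> Jf" using B by (simp add: top_set_def)
  \<comment> \<open>The price of a unit of budget. Inserting 0 makes it nonnegative, and 0 if
    \<open>Jf - B\<close> is empty.\<close>
  define \<tau> where "\<tau> = Max (insert 0 (?h ` (Jf - B)))"
  have \<tau>: "0 \<le> \<tau>" "\<And>i. i \<in> Jf - B \<Longrightarrow> ?h i \<le> \<tau>" by (auto simp: \<tau>_def)
  have \<tau>_le: "\<tau> \<le> ?h j" if "j \<in> B" for j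
    unfolding \<tau>_def using B that M_pos by (auto simp: top_set_def intro: huber_nonneg huber_mono)
  have "z $ j * ?h j \<le> ?h j - \<tau> * (1 - z $ j)" if "j \<in> B" for j
    using mult_right_mono[OF \<tau>_le[OF that], of "1 - z $ j"] feasibleD(2)[OF z, of j]
    by (simp add: algebra_simps)
  then have "(\<Sum>j\<in>B. z $ j * ?h j) \<le> (\<Sum>j\<in>B. ?h j - \<tau> * (1 - z $ j))" by (rule sum_mono)
  also have "\<dots> = (\<Sum>j\<in>B. ?h j) - \<tau> * (real (card B) - (\<Sum>j\<in>B. z $ j))"
    by (simp add: sum_subtractf flip: sum_distrib_left)
  finally have 1: "(\<Sum>j\<in>B. z $ j * ?h j) \<le> (\<Sum>j\<in>B. ?h j) - \<tau> * (real (card B) - (\<Sum>j\<in>B. z $ j))" .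
  have "(\<Sum>j\<in>Jf - B. z $ j * ?h j) \<le> (\<Sum>j\<in>Jf - B. z $ j * \<tau>)"
    by (intro sum_mono mult_left_mono \<tau>(2) feasibleD(1)[OF z])
  then have 2: "(\<Sum>j\<in>Jf - B. z $ j * ?h j) \<le> \<tau> * (\<Sum>j\<in>Jf - B. z $ j)"
    by (simp add: sum_distrib_left mult.commute)
  \<comment> \<open>Complementary slackness: either the price is 0 or \<open>B\<close> has exactly
    \<open>free\<close> elements.\<close>
  have 3: "\<tau> * ((\<Sum>j\<in>B. z $ j) + (\<Sum>j\<in>Jf - B. z $ j)) \<le> \<tau> * real (card B)"
  proof (cases "B = Jf")
    case True
    then show ?thesis by (simp add: \<tau>_def)
  next
    case False
    then have "card B = free" using B by (simp add: top_set_def)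
    then show ?thesis using feasibleD(9)[OF z] sum.subset_diff[OF BJ, of "\<lambda>j. z $ j"] \<tau>(1)
      by (intro mult_left_mono) auto
  qed
  have "(\<Sum>j\<in>J0. z $ j * ?h j) = 0" "(\<Sum>j\<in>J1. z $ j * ?h j) = (\<Sum>j\<in>J1. ?h j)"
    using feasibleD(6,7)[OF z] by simp_all
  then show ?thesis using 1 2 3
    by (simp add: sum_split_free[OF BJ] sum_J1_Un[OF BJ] algebra_simps)
qed

text \<open>The upper bound applies Fenchel-Young in each coordinate at an optimal z and then the
  knapsack bound. For the lower bound a single feasible pair suffices, since its cost is at least
  \<open>g \<beta>\<close>.\<close>

lemma conjugate_node_fun:
  assumes B: "top_set \<alpha> B"
  shows "fenchel_conjugate g \<alpha> = ereal (\<Sum>j\<in>J1 \<union> B. huber M (\<alpha> $ j))" (is "_ = ereal ?V")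
proof (rule antisym)
  have BJ: "B \<subseteq> Jf" "card B \<le> free" using B by (auto simp: top_set_def)
  show "fenchel_conjugate g \<alpha> \<le> ereal ?V"
    unfolding fenchel_conjugate_def
  proof (rule SUP_least)
    fix \<beta>
    show "ereal (\<alpha> \<bullet> \<beta>) - g \<beta> \<le> ereal ?V"
    proof (cases "\<beta> \<in> dom_of g")
      case True
      then obtain w where "feasible \<beta> w" by (rule dom_of_node_fun_feasible)
      then obtain z where z: "feasible \<beta> z" and gz: "g \<beta> = ereal (objective \<beta> z)"
        by (rule node_fun_attained)
      have "\<alpha> \<bullet> \<beta> - objective \<beta> z = (\<Sum>j\<in>UNIV. \<alpha> $ j * \<beta> $ j - 1/2 * ((\<beta> $ j)\<^sup>2 / z $ j))"
        by (simp only: inner_vec_def inner_real_def objective_def sum_subtractf sum_distrib_left)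
      also have "\<dots> \<le> (\<Sum>j\<in>UNIV. z $ j * huber M (\<alpha> $ j))"
        by (intro sum_mono fenchel_young_perspective M_pos feasibleD(1,3)[OF z])
      also have "\<dots> \<le> ?V" by (rule knapsack_le_top_set[OF B z])
      finally show ?thesis by (simp add: gz)
    next
      case False
      then have "g \<beta> = \<infinity>" by (simp add: dom_of_def)
      then show ?thesis by simp
    qed
  qed
  \<comment> \<open>With z the indicator of \<open>J1 \<union> B\<close>, the coordinatewise
    maximizers are the clipped values; the other coordinates contribute
    \<open>0 / 0 = 0\<close>.\<close>
  define \<beta> :: "real^'n" where "\<beta> = (\<chi> j. if j \<in> J1 \<union> B then clip M (\<alpha> $ j) else 0)"
  define z :: "real^'n" where "z = (\<chi> j. if j \<in> J1 \<union> B then 1 else 0)"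
  have "card (J1 \<union> B) = card J1 + card B" using BJ disjoint by (intro card_Un_disjoint) auto
  then have "(\<Sum>j\<in>UNIV. z $ j) \<le> real k"
    using BJ(2) card_J1 by (simp add: z_def sum.If_cases free_def flip: Un_def)
  moreover have "j \<notin> J1 \<union> B" if "j \<in> J0" for j using that BJ disjoint by blast
  ultimately have feas: "feasible \<beta> z"
    using M_pos by (auto simp: node_feasible_def z_def \<beta>_def abs_clip_le)
  have "(\<Sum>j\<in>UNIV. \<alpha> $ j * \<beta> $ j - 1/2 * ((\<beta> $ j)\<^sup>2 / z $ j))
      = (\<Sum>j\<in>UNIV. if j \<in> J1 \<union> B then huber M (\<alpha> $ j) else 0)"
    by (rule sum.cong) (auto simp: \<beta>_def z_def huber_def)
  also have "\<dots> = ?V" by (simp add: sum.If_cases flip: Un_def)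
  finally have "?V = \<alpha> \<bullet> \<beta> - objective \<beta> z"
    by (simp only: inner_vec_def inner_real_def objective_def sum_subtractf sum_distrib_left)
  then have "ereal ?V = ereal (\<alpha> \<bullet> \<beta>) - ereal (objective \<beta> z)" by simp
  also have "\<dots> \<le> ereal (\<alpha> \<bullet> \<beta>) - g \<beta>" by (intro ereal_minus_mono node_fun_le[OF feas]) simp
  also have "\<dots> \<le> fenchel_conjugate g \<alpha>" unfolding fenchel_conjugate_def by (rule SUP_upper) simp
  finally show "ereal ?V \<le> fenchel_conjugate g \<alpha>" .
qed

text \<open>On a piece, \<open>S\<close> fixes the signs, \<open>L\<close> the indices on the linear branches of the Huber function,
  and \<open>B\<close> a set of free indices with largest \<open>\<bar>\<alpha> $ j\<bar>\<close>.\<close>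

definition conjugate_piece :: "'n set \<times> 'n set \<times> 'n set \<Rightarrow> (real^'n) set" where
  "conjugate_piece = (\<lambda>(S, L, B). {\<alpha>. (\<forall>j\<in>UNIV. 0 \<le> signed S j * \<alpha> $ j) \<and>
     (\<forall>j\<in>L. M \<le> signed S j * \<alpha> $ j) \<and> (\<forall>j\<in>- L. signed S j * \<alpha> $ j \<le> M) \<and>
     (\<forall>i\<in>Jf - B. \<forall>j\<in>B. signed S i * \<alpha> $ i \<le> signed S j * \<alpha> $ j)})"

text \<open>The constant of the linear branch is written as an added
  \<open>- (M\<^sup>2 / 2)\<close> to match \<open>quadratic_fun_linear\<close>.\<close>

definition conjugate_quadratic :: "'n set \<times> 'n set \<times> 'n set \<Rightarrow> real^'n \<Rightarrow> real" where
  "conjugate_quadratic = (\<lambda>(S, L, B) \<alpha>.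
     (\<Sum>j\<in>(J1 \<union> B) \<inter> L. M * signed S j * \<alpha> $ j + - (M\<^sup>2 / 2)) + 1/2 * (\<Sum>j\<in>(J1 \<union> B) - L. (1 * \<alpha> $ j)\<^sup>2))"

lemma polyhedron_conjugate_piece: "polyhedron (conjugate_piece SLB)"
  unfolding conjugate_piece_def case_prod_beta
  by (intro polyhedron_Collect_conj polyhedron_Collect_ball polyhedron_linear_le_const
      polyhedron_linear_le_linear linear_scaled_component finite)

lemma quadratic_fun_conjugate_quadratic: "quadratic_fun (conjugate_quadratic SLB)"
  unfolding conjugate_quadratic_def case_prod_beta
  by (intro quadratic_fun_cmult quadratic_fun_add[OF quadratic_fun_sum] quadratic_fun_sum
      quadratic_fun_linear_square quadratic_fun_linear linear_scaled_component)

text \<open>The closed pieces overlap where \<open>\<bar>\<alpha> $ j\<bar> = M\<close> and at ties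
  for \<open>B\<close>. They agree there because each quadratic is shown equal to the conjugate
  itself on its piece.\<close>

lemma conjugate_piece_value:
  assumes B: "B \<subseteq> Jf" "card B \<le> free" "card B = free \<or> B = Jf"
    and \<alpha>: "\<alpha> \<in> conjugate_piece (S, L, B)"
  shows "fenchel_conjugate g \<alpha> = ereal (conjugate_quadratic (S, L, B) \<alpha>)"
proof -
  have abs: "signed S j * \<alpha> $ j = \<bar>\<alpha> $ j\<bar>" for j
    using \<alpha> by (intro signed_mult_eq_abs) (simp add: conjugate_piece_def)
  have "top_set \<alpha> B" using B \<alpha> by (simp add: top_set_def conjugate_piece_def abs)
  then have "fenchel_conjugate g \<alpha> = ereal (\<Sum>j\<in>J1 \<union> B. huber M (\<alpha> $ j))"
    by (rule conjugate_node_fun)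
  also have "(\<Sum>j\<in>J1 \<union> B. huber M (\<alpha> $ j))
      = (\<Sum>j\<in>(J1 \<union> B) \<inter> L. huber M (\<alpha> $ j)) + (\<Sum>j\<in>(J1 \<union> B) - L. huber M (\<alpha> $ j))"
    by (rule sum.Int_Diff) simp
  also have "(\<Sum>j\<in>(J1 \<union> B) \<inter> L. huber M (\<alpha> $ j))
      = (\<Sum>j\<in>(J1 \<union> B) \<inter> L. M * signed S j * \<alpha> $ j + - (M\<^sup>2 / 2))"
    using \<alpha> M_pos by (intro sum.cong refl) (auto simp: conjugate_piece_def abs huber_outer mult.assoc)
  also have "(\<Sum>j\<in>(J1 \<union> B) - L. huber M (\<alpha> $ j)) = 1/2 * (\<Sum>j\<in>(J1 \<union> B) - L. (1 * \<alpha> $ j)\<^sup>2)"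
    using \<alpha> by (auto simp: conjugate_piece_def abs huber_inner sum_divide_distrib intro!: sum.cong)
  finally show ?thesis by (simp add: conjugate_quadratic_def)
qed

text \<open>Every point has a top set, so the pieces cover the whole space and the conjugate is
  finite everywhere.\<close>

lemma plq_conjugate_node_fun: "plq (fenchel_conjugate g)"
proof (rule plqI)
  define I where "I = (UNIV :: 'n set set) \<times> (UNIV :: 'n set set) \<times>
    {B. B \<subseteq> Jf \<and> card B \<le> free \<and> (card B = free \<or> B = Jf)}"
  show "finite I" by (rule finite)
  show "polyhedron (conjugate_piece i)" "quadratic_fun (conjugate_quadratic i)" for i
    by (rule polyhedron_conjugate_piece quadratic_fun_conjugate_quadratic)+
  show val: "fenchel_conjugate g \<alpha> = ereal (conjugate_quadratic i \<alpha>)"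
    if "i \<in> I" "\<alpha> \<in> conjugate_piece i" for i \<alpha>
    using that conjugate_piece_value by (cases i) (auto simp: I_def)
  show "dom_of (fenchel_conjugate g) = (\<Union>i\<in>I. conjugate_piece i)"
  proof (intro equalityI subsetI)
    fix \<alpha> :: "real^'n"
    obtain B where B: "top_set \<alpha> B" using top_set_exists by blast
    then have "\<alpha> \<in> conjugate_piece ({j. 0 \<le> \<alpha> $ j}, {j. M \<le> \<bar>\<alpha> $ j\<bar>}, B)"
      by (auto simp: conjugate_piece_def signed_nonneg_set top_set_def)
    then show "\<alpha> \<in> (\<Union>i\<in>I. conjugate_piece i)" using B by (auto simp: I_def top_set_def)
  next
    fix \<alpha> assume "\<alpha> \<in> (\<Union>i\<in>I. conjugate_piece i)"
    then show "\<alpha> \<in> dom_of (fenchel_conjugate g)" using val by (auto simp: dom_of_def)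
  qed
qed

lemma proper_conjugate_node_fun: "proper_fun (fenchel_conjugate g)"
proof -
  have "\<exists>r. fenchel_conjugate g \<alpha> = ereal r" for \<alpha>
    using top_set_exists conjugate_node_fun by blast
  then show ?thesis unfolding proper_fun_def by (metis MInfty_neq_ereal(1) PInfty_neq_ereal(1))
qed

end

theorem lemma4p3:
  fixes k :: nat and M :: real and J0 J1 Jf :: "'n::finite set"
  assumes "M > 0"
    and "J0 \<union> J1 \<union> Jf = UNIV"
    and "J0 \<inter> J1 = {}" and "J0 \<inter> Jf = {}" and "J1 \<inter> Jf = {}"
    and "card J1 \<le> k"
  shows "plq (node_fun k M J0 J1 Jf) \<and> firmly_convex (node_fun k M J0 J1 Jf) \<and>
         plq (fenchel_conjugate (node_fun k M J0 J1 Jf)) \<and>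
         firmly_convex (fenchel_conjugate (node_fun k M J0 J1 Jf))"
proof -
  interpret node k M J0 J1 Jf using assms by unfold_locales
  show ?thesis
    using plq_node_fun convex_node_fun proper_node_fun
      plq_conjugate_node_fun convex_fenchel_conjugate proper_conjugate_node_fun
    by (intro conjI plq_convex_imp_firmly_convex)
qed

end
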